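(* Let $k$ be a field and $d\ge 2$. Let $J$ be a strongly stable monomial ideal of $R=k[x_1,\ldots,x_n]$ generated in degrees $\ge d$ and containing every monomial of degree $d$ not divisible by $x_n$. Suppose $R/J$ is Artinian. Then $$\beta_p(R/J)=\beta_p(R/\mathfrak m^d)=\sum_{i=1}^n\binom{d+i-2}{d-1}\binom{i-1}{p-1}\quad\text{for all }p\ge 1,$$ where $\mathfrak m=(x_1,\ldots,x_n)$. In particular, $J$ is minimally generated by $\dim_k R_d$ monomials.
   Context: $R$ is standard graded and $R_d$ is its degree $d$ component. A monomial ideal $J$ of $R$ is strongly stable if for every monomial $m\in J$, every variable $x_i$ dividing $m$ and every $j<i$, the monomial $(x_j/x_i)m$ also belongs to $J$. $\beta_p(M)$ denotes the $p$-th total Betti number of the finitely generated graded $R$-module $M$, i.e. the rank of the $p$-th free module in its minimal graded free resolution over $R$. *)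

theory Defs
  imports
    Complex_Main
    "HOL-Library.Poly_Mapping"
    "HOL-Algebra.Module"
    "HOL-Algebra.QuotRing"
    "HOL-Algebra.Ideal_Product"
begin

section \<open>The standard graded polynomial ring\<close>

text \<open>Polynomials over a field in variables indexed by naturals, as finitely supported
  functions from exponent vectors to coefficients; the multiplication of
  \<open>HOL-Library.Poly_Mapping\<close> is convolution.  The ring in the variables
  \<open>x\<^sub>1, \<dots>, x\<^sub>n\<close> is the subring of polynomials whose exponent vectors are supported
  in \<open>{1..n}\<close>.\<close>

type_synonym 'k mpoly = "(nat \<Rightarrow>\<^sub>0 nat) \<Rightarrow>\<^sub>0 'k"

definition exponents :: "nat \<Rightarrow> (nat \<Rightarrow>\<^sub>0 nat) set" where
  "exponents n = {m. Poly_Mapping.keys m \<subseteq> {1..n}}"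

definition exp_degree :: "(nat \<Rightarrow>\<^sub>0 nat) \<Rightarrow> nat" where
  "exp_degree m = (\<Sum>i\<in>Poly_Mapping.keys m. Poly_Mapping.lookup m i)"

definition monomial :: "(nat \<Rightarrow>\<^sub>0 nat) \<Rightarrow> 'k::field mpoly" where
  "monomial m = Poly_Mapping.single m 1"

definition poly_ring :: "nat \<Rightarrow> 'k::field mpoly ring" where
  "poly_ring n = \<lparr>carrier = {f. Poly_Mapping.keys f \<subseteq> exponents n},
     mult = (*), one = 1, zero = 0, add = (+)\<rparr>"

definition homogeneous_part :: "nat \<Rightarrow> int \<Rightarrow> 'k::field mpoly set" where
  "homogeneous_part n e =
     {f \<in> carrier (poly_ring n). \<forall>m\<in>Poly_Mapping.keys f. int (exp_degree m) = e}"

definition k_dim :: "'k::field mpoly set \<Rightarrow> nat" where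
  "k_dim V = vector_space.dim (\<lambda>c f. Poly_Mapping.single 0 c * f) V"

definition irrelevant_ideal :: "nat \<Rightarrow> 'k::field mpoly set" where
  "irrelevant_ideal n =
     genideal (poly_ring n) ((\<lambda>i. monomial (Poly_Mapping.single i 1)) ` {1..n})"

definition irrelevant_power :: "nat \<Rightarrow> nat \<Rightarrow> 'k::field mpoly set" where
  "irrelevant_power n d = irrelevant_ideal n [^]\<^bsub>ideals_set (poly_ring n)\<^esub> d"


section \<open>Monomial ideals\<close>

definition monomial_ideal :: "nat \<Rightarrow> 'k::field mpoly set \<Rightarrow> bool" where
  "monomial_ideal n J \<longleftrightarrow> (\<exists>S\<subseteq>exponents n. J = genideal (poly_ring n) (monomial ` S))"

text \<open>For \<open>i \<in> keys m\<close> the exponent vector \<open>m - single i 1 + single j 1\<close> is that of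
  \<open>(x\<^sub>j/x\<^sub>i) m\<close>; the pointwise truncated subtraction is exact there.\<close>

definition strongly_stable :: "nat \<Rightarrow> 'k::field mpoly set \<Rightarrow> bool" where
  "strongly_stable n J \<longleftrightarrow> monomial_ideal n J \<and>
     (\<forall>m\<in>exponents n. monomial m \<in> J \<longrightarrow>
        (\<forall>i\<in>Poly_Mapping.keys m. \<forall>j. 1 \<le> j \<and> j < i \<longrightarrow>
           monomial (m - Poly_Mapping.single i 1 + Poly_Mapping.single j 1) \<in> J))"

definition generated_in_degrees_ge :: "nat \<Rightarrow> nat \<Rightarrow> 'k::field mpoly set \<Rightarrow> bool" where
  "generated_in_degrees_ge n d J \<longleftrightarrow>
     (\<exists>G \<subseteq> (\<Union>e\<in>{int d..}. homogeneous_part n e). J = genideal (poly_ring n) G)"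

definition minimal_monomial_generators ::
    "nat \<Rightarrow> 'k::field mpoly set \<Rightarrow> 'k mpoly set \<Rightarrow> bool" where
  "minimal_monomial_generators n J G \<longleftrightarrow>
     G \<subseteq> monomial ` exponents n \<and> J = genideal (poly_ring n) G \<and>
     (\<forall>H. H \<subset> G \<longrightarrow> genideal (poly_ring n) H \<noteq> J)"

definition artinian_ring :: "('a, 'b) ring_scheme \<Rightarrow> bool" where
  "artinian_ring A \<longleftrightarrow> ring A \<and>
     (\<forall>I :: nat \<Rightarrow> 'a set. (\<forall>i. ideal (I i) A) \<and> (\<forall>i. I (Suc i) \<subseteq> I i) \<longrightarrow>
        (\<exists>N. \<forall>i\<ge>N. I i = I N))"


section \<open>Graded modules\<close>

text \<open>The ring-multiplication fields that the record type \<open>module\<close> inherits from \<open>ring\<close> play no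
  role for modules.\<close>

record ('a, 'b) gmodule = "('a, 'b) module" +
  component :: "int \<Rightarrow> 'b set"

definition graded_module :: "nat \<Rightarrow> ('k::field mpoly, 'b) gmodule \<Rightarrow> bool" where
  "graded_module n M \<longleftrightarrow> Module.module (poly_ring n) M \<and>
     (\<forall>e. additive_subgroup (component M e) M) \<and>
     (\<forall>c e. \<forall>f\<in>homogeneous_part n c. \<forall>x\<in>component M e. f \<odot>\<^bsub>M\<^esub> x \<in> component M (c + e)) \<and>
     (\<forall>x\<in>carrier M. \<exists>!u. (\<forall>e. u e \<in> component M e) \<and> finite {e. u e \<noteq> \<zero>\<^bsub>M\<^esub>} \<and>
        x = finsum M u {e. u e \<noteq> \<zero>\<^bsub>M\<^esub>})"

definition graded_hom ::
    "nat \<Rightarrow> ('k::field mpoly, 'b) gmodule \<Rightarrow> ('k mpoly, 'c) gmodule \<Rightarrow> ('b \<Rightarrow> 'c) \<Rightarrow> bool" where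
  "graded_hom n M N h \<longleftrightarrow> h \<in> carrier M \<rightarrow> carrier N \<and>
     (\<forall>x\<in>carrier M. \<forall>y\<in>carrier M. h (x \<oplus>\<^bsub>M\<^esub> y) = h x \<oplus>\<^bsub>N\<^esub> h y) \<and>
     (\<forall>f\<in>carrier (poly_ring n). \<forall>x\<in>carrier M. h (f \<odot>\<^bsub>M\<^esub> x) = f \<odot>\<^bsub>N\<^esub> h x) \<and>
     (\<forall>e. h ` component M e \<subseteq> component N e)"

definition quotient_module :: "nat \<Rightarrow> 'k::field mpoly set \<Rightarrow> ('k mpoly, 'k mpoly set) gmodule" where
  "quotient_module n J = (let Q = poly_ring n Quot J in
     \<lparr>carrier = carrier Q, mult = mult Q, one = one Q, zero = zero Q, add = add Q,
      smult = (\<lambda>f X. (J +>\<^bsub>poly_ring n\<^esub> f) \<otimes>\<^bsub>Q\<^esub> X),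
      component = (\<lambda>e. (\<lambda>f. J +>\<^bsub>poly_ring n\<^esub> f) ` homogeneous_part n e)\<rparr>)"

text \<open>The graded free module \<open>R(-a\<^sub>0) \<oplus> \<dots> \<oplus> R(-a\<^sub>r\<^sub>-\<^sub>1)\<close> for \<open>as = [a\<^sub>0, \<dots>, a\<^sub>r\<^sub>-\<^sub>1]\<close>: vectors
  are functions that vanish from index \<open>r = length as\<close> on, and the \<open>j\<close>-th basis vector has
  degree \<open>a\<^sub>j\<close>.\<close>

definition free_module :: "nat \<Rightarrow> int list \<Rightarrow> ('k::field mpoly, nat \<Rightarrow> 'k mpoly) gmodule" where
  "free_module n as =
     \<lparr>carrier = {v. (\<forall>j<length as. v j \<in> carrier (poly_ring n)) \<and> (\<forall>j\<ge>length as. v j = 0)},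
      mult = undefined, one = undefined,
      zero = (\<lambda>j. 0), add = (\<lambda>v w j. v j + w j), smult = (\<lambda>f v j. f * v j),
      component = (\<lambda>e. {v. (\<forall>j<length as. v j \<in> homogeneous_part n (e - as ! j)) \<and>
                            (\<forall>j\<ge>length as. v j = 0)})\<rparr>"


section \<open>Minimal graded free resolutions and Betti numbers\<close>

text \<open>A graded free resolution \<open>\<dots> \<rightarrow> F\<^sub>2 \<rightarrow> F\<^sub>1 \<rightarrow> F\<^sub>0 \<rightarrow> M \<rightarrow> 0\<close> by free modules of finite rank,
  with \<open>F\<^sub>p = free_module n (as p)\<close>, differentials \<open>\<delta> p : F\<^sub>p\<^sub>+\<^sub>1 \<rightarrow> F\<^sub>p\<close> and augmentation
  \<open>\<epsilon> : F\<^sub>0 \<rightarrow> M\<close>, all homogeneous of degree 0.\<close>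

definition graded_free_resolution ::
    "nat \<Rightarrow> ('k::field mpoly, 'b) gmodule \<Rightarrow> (nat \<Rightarrow> int list) \<Rightarrow>
     (nat \<Rightarrow> (nat \<Rightarrow> 'k mpoly) \<Rightarrow> (nat \<Rightarrow> 'k mpoly)) \<Rightarrow> ((nat \<Rightarrow> 'k mpoly) \<Rightarrow> 'b) \<Rightarrow> bool" where
  "graded_free_resolution n M as \<delta> \<epsilon> \<longleftrightarrow>
     (let F = (\<lambda>p. free_module n (as p)) in
       graded_module n M \<and>
       graded_hom n (F 0) M \<epsilon> \<and> (\<forall>p. graded_hom n (F (Suc p)) (F p) (\<delta> p)) \<and>
       \<epsilon> ` carrier (F 0) = carrier M \<and>
       a_kernel (F 0) M \<epsilon> = \<delta> 0 ` carrier (F 1) \<and>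
       (\<forall>p. a_kernel (F (Suc p)) (F p) (\<delta> p) = \<delta> (Suc p) ` carrier (F (Suc (Suc p)))))"

text \<open>Minimality is \<open>\<delta> p (F\<^sub>p\<^sub>+\<^sub>1) \<subseteq> \<mm> F\<^sub>p\<close>; the submodule \<open>\<mm> F\<^sub>p\<close> consists of the vectors with all
  entries in \<open>\<mm>\<close>.\<close>

definition minimal_graded_free_resolution ::
    "nat \<Rightarrow> ('k::field mpoly, 'b) gmodule \<Rightarrow> (nat \<Rightarrow> int list) \<Rightarrow>
     (nat \<Rightarrow> (nat \<Rightarrow> 'k mpoly) \<Rightarrow> (nat \<Rightarrow> 'k mpoly)) \<Rightarrow> ((nat \<Rightarrow> 'k mpoly) \<Rightarrow> 'b) \<Rightarrow> bool" where
  "minimal_graded_free_resolution n M as \<delta> \<epsilon> \<longleftrightarrow>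
     graded_free_resolution n M as \<delta> \<epsilon> \<and>
     (\<forall>p. \<forall>v\<in>carrier (free_module n (as (Suc p))).
        \<forall>j<length (as p). \<delta> p v j \<in> irrelevant_ideal n)"

text \<open>The definite description is meaningful because a finitely generated graded module has a
  minimal graded free resolution, unique up to isomorphism; a value of \<open>betti\<close> can only be
  established by proving existence of such a resolution and uniqueness of its ranks.\<close>

definition betti :: "nat \<Rightarrow> ('k::field mpoly, 'b) gmodule \<Rightarrow> nat \<Rightarrow> nat" where
  "betti n M p =
     (THE r. \<exists>as \<delta> \<epsilon>. minimal_graded_free_resolution n M as \<delta> \<epsilon> \<and> r = length (as p))"

end

theory Submission
  imports Defs "HOL-Library.Function_Algebras"
begin

text \<open>The ideal \<open>J\<close> has linear quotients: when its minimal monomial generators are added in order of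
  increasing degree and, within a degree, in decreasing lexicographic order, each generator \<open>u\<close>
  meets the colon ideal \<open>(x\<^sub>1, \<dots>, x\<^sub>t\<^sub>-\<^sub>1)\<close>, where \<open>t\<close> is the largest index of a variable dividing \<open>u\<close>.
  An iterated mapping cone over Koszul complexes (themselves mapping cones of the same kind) is
  minimal for degree reasons, and it shows that \<open>u\<close> contributes \<open>binomial (t - 1) (p - 1)\<close> to the
  \<open>p\<close>-th Betti number.  Sending a monomial \<open>m x\<^sub>n\<^sup>b\<close> of degree \<open>d\<close>, with \<open>m\<close> free of \<open>x\<^sub>n\<close>, to \<open>m x\<^sub>n\<^sup>a\<close>
  with \<open>a\<close> minimal such that this lies in \<open>J\<close> is a bijection onto the minimal generators that
  preserves \<open>t\<close>; such an \<open>a\<close> exists because \<open>R/J\<close> is Artinian.  Hence the Betti numbers depend only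
  on \<open>n\<close> and \<open>d\<close>, and \<open>\<mm>\<^sup>d\<close> is another such ideal.\<close>

text \<open>\<open>betti\<close> is a definite description, so exhibiting a resolution is only half
  of the work: any two minimal resolutions must be shown to have equal ranks. This is done without
  Tor, by comparison maps whose matrices of constant terms are one-sided inverses over
  \<open>k\<close>.

  The danger in a mapping cone is a nonzero constant among the entries of the comparison map. If all
  generators before \<open>u\<close> have degree at most \<open>D = exp_degree u\<close>, then
  position \<open>p \<ge> 1\<close> of the resolution built so far has shifts at most
  \<open>D + p - 1\<close>, whereas the Koszul complex shifted by \<open>D\<close> sits at position
  \<open>p\<close> in degree exactly \<open>D + p\<close>; all entries therefore have positive
  degree. This is why degree is the primary sorting key. The lexicographic key serves the colon
  ideal: for \<open>i < t\<close> the monomial \<open>(x_i / x_t) u\<close> lies in the ideal and is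
  lexicographically larger than \<open>u\<close>, so a generator dividing it has been added before
  \<open>u\<close>.\<close>

abbreviation (input) "keys \<equiv> Poly_Mapping.keys"
abbreviation (input) "lookup \<equiv> Poly_Mapping.lookup"
abbreviation (input) "single \<equiv> Poly_Mapping.single"

section \<open>Polynomials with prescribed support\<close>

text \<open>The ring itself, its graded pieces, the maximal ideal, its powers and all monomial
  ideals are spans of monomials; one notion parametrised by a set of exponents serves for all of
  them and turns ideal membership into a condition on \<open>keys\<close>.\<close>

definition supported_on :: "(nat \<Rightarrow>\<^sub>0 nat) set \<Rightarrow> 'k::field mpoly set" where
  "supported_on S = {f. keys f \<subseteq> S}"

lemma supported_on_iff: "f \<in> supported_on S \<longleftrightarrow> keys f \<subseteq> S"
  by (simp add: supported_on_def)

lemma supported_on_mono: "S \<subseteq> T \<Longrightarrow> supported_on S \<subseteq> supported_on T"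
  by (auto simp: supported_on_def)

lemma supported_on_0 [simp, intro]: "0 \<in> supported_on S"
  by (simp add: supported_on_def)

lemma supported_on_add [intro]: "f \<in> supported_on S \<Longrightarrow> g \<in> supported_on S \<Longrightarrow> f + g \<in> supported_on S"
  using keys_add[of f g] by (auto simp: supported_on_def)

lemma supported_on_uminus [intro]: "f \<in> supported_on S \<Longrightarrow> - f \<in> supported_on S"
  by (simp add: supported_on_def)

lemma supported_on_diff [intro]: "f \<in> supported_on S \<Longrightarrow> g \<in> supported_on S \<Longrightarrow> f - g \<in> supported_on S"
  using keys_diff[of f g] by (auto simp: supported_on_def)

lemma supported_on_sum: "(\<And>i. i \<in> A \<Longrightarrow> f i \<in> supported_on S) \<Longrightarrow> sum f A \<in> supported_on S"
  by (induction A rule: infinite_finite_induct) auto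

lemma supported_on_mult:
  assumes "f \<in> supported_on S" "g \<in> supported_on T" "\<And>a b. a \<in> S \<Longrightarrow> b \<in> T \<Longrightarrow> a + b \<in> U"
  shows "f * g \<in> supported_on U"
  using keys_mult[of f g] assms by (fastforce simp: supported_on_def)

lemma single_in_supported_on: "single m c \<in> supported_on S \<longleftrightarrow> c = 0 \<or> m \<in> S"
  by (simp add: supported_on_def)

lemma monomial_in_supported_on [simp]: "monomial m \<in> supported_on S \<longleftrightarrow> m \<in> S"
  by (simp add: monomial_def single_in_supported_on)

lemma poly_mapping_eq_sum_single: "f = (\<Sum>m\<in>keys f. single m (lookup f m))"
proof (rule poly_mapping_eqI)
  fix k
  show "lookup f k = lookup (\<Sum>m\<in>keys f. single m (lookup f m)) k"
    by (cases "k \<in> keys f")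
       (auto simp: lookup_sum lookup_single when_def sum.delta not_in_keys_iff_lookup_eq_zero)
qed

lemma lookup_monomial_mult: "lookup (monomial u * f) (u + w) = lookup f w"
proof -
  have "monomial u * f = (\<Sum>m\<in>keys f. single (u + m) (lookup f m))"
    by (subst poly_mapping_eq_sum_single[of f])
       (simp add: monomial_def sum_distrib_left mult_single)
  then show ?thesis
    by (cases "w \<in> keys f")
       (auto simp: lookup_sum lookup_single when_def sum.delta not_in_keys_iff_lookup_eq_zero)
qed

text \<open>Multiplication by a monomial translates exponents injectively, so nothing cancels; this
  makes colon ideals by monomials computable on exponents.\<close>

lemma keys_monomial_mult: "keys (monomial u * f) = (+) u ` keys f"
proof
  show "keys (monomial u * f) \<subseteq> (+) u ` keys f"
    using keys_mult[of "monomial u" f] by (auto simp: monomial_def split: if_splits)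
  show "(+) u ` keys f \<subseteq> keys (monomial u * f)"
    by (auto simp: in_keys_iff lookup_monomial_mult)
qed

lemma exponents_0 [simp, intro]: "0 \<in> exponents n"
  by (simp add: exponents_def)

lemma exponents_add [intro]: "a \<in> exponents n \<Longrightarrow> b \<in> exponents n \<Longrightarrow> a + b \<in> exponents n"
  using keys_add[of a b] by (auto simp: exponents_def)

lemma exponents_diff [intro]: "a \<in> exponents n \<Longrightarrow> a - b \<in> exponents n"
  by (auto simp: exponents_def in_keys_iff lookup_minus)

lemma exponents_single [intro]: "i \<in> {1..n} \<Longrightarrow> single i k \<in> exponents n"
  by (auto simp: exponents_def)

lemma poly_ring_simps [simp]:
  "carrier (poly_ring n) = supported_on (exponents n)"
  "mult (poly_ring n) = (*)"
  "one (poly_ring n) = 1"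
  "zero (poly_ring n) = 0"
  "add (poly_ring n) = (+)"
  by (auto simp: poly_ring_def supported_on_def)

lemma poly_ring_mult_closed [intro]:
  "f \<in> supported_on (exponents n) \<Longrightarrow> g \<in> supported_on (exponents n) \<Longrightarrow> f * g \<in> supported_on (exponents n)"
  by (rule supported_on_mult) auto

lemma poly_ring_one_closed [simp, intro]: "1 \<in> supported_on (exponents n)"
  by (simp add: supported_on_def)

lemma cring_poly_ring: "cring (poly_ring n)"
proof (rule cringI)
  show "abelian_group (poly_ring n)"
    by (rule abelian_groupI) (auto simp: algebra_simps intro!: bexI[of _ "- x" for x])
  show "Group.comm_monoid (poly_ring n)"
    by (rule comm_monoidI) (auto simp: algebra_simps)
qed (auto simp: algebra_simps)

lemma a_inv_poly_ring:
  assumes "f \<in> supported_on (exponents n)"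
  shows "\<ominus>\<^bsub>poly_ring n\<^esub> f = - f"
proof -
  interpret cring "poly_ring n" by (rule cring_poly_ring)
  show ?thesis
    using minus_equality[of "- f" f] assms by auto
qed

section \<open>Monomial ideals as upward closed sets of exponents\<close>

definition upset :: "nat \<Rightarrow> (nat \<Rightarrow>\<^sub>0 nat) set \<Rightarrow> bool" where
  "upset n S \<longleftrightarrow> S \<subseteq> exponents n \<and> (\<forall>m\<in>S. \<forall>w\<in>exponents n. m + w \<in> S)"

definition up_closure :: "nat \<Rightarrow> (nat \<Rightarrow>\<^sub>0 nat) set \<Rightarrow> (nat \<Rightarrow>\<^sub>0 nat) set" where
  "up_closure n S = {s + w | s w. s \<in> S \<and> w \<in> exponents n}"

lemma upset_subset: "upset n S \<Longrightarrow> S \<subseteq> exponents n"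
  by (simp add: upset_def)

lemma upset_add: "upset n S \<Longrightarrow> m \<in> S \<Longrightarrow> w \<in> exponents n \<Longrightarrow> m + w \<in> S"
  by (simp add: upset_def)

lemma upset_up_closure: "S \<subseteq> exponents n \<Longrightarrow> upset n (up_closure n S)"
  unfolding upset_def up_closure_def by (auto simp: add.assoc) (metis exponents_add add.assoc)

lemma up_closure_superset: "S \<subseteq> up_closure n S"
  unfolding up_closure_def using exponents_0 by (force intro: exI[of _ 0])

lemma up_closure_least: "upset n T \<Longrightarrow> S \<subseteq> T \<Longrightarrow> up_closure n S \<subseteq> T"
  by (auto simp: up_closure_def intro: upset_add)

lemma up_closure_Un: "up_closure n (S \<union> T) = up_closure n S \<union> up_closure n T"
  by (auto simp: up_closure_def)

lemma ideal_mult_supported_on: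
  assumes "upset n S" "f \<in> supported_on S" "g \<in> supported_on (exponents n)"
  shows "g * f \<in> supported_on S" "f * g \<in> supported_on S"
  using supported_on_mult[of f S g "exponents n" S] upset_add[OF assms(1)] assms
  by (auto simp: mult.commute)

lemma ideal_supported_on:
  assumes "upset n S"
  shows "ideal (supported_on S) (poly_ring n)"
proof (rule idealI)
  interpret cring "poly_ring n" by (rule cring_poly_ring)
  show "ring (poly_ring n)" by (rule ring_axioms)
  have S: "supported_on S \<subseteq> supported_on (exponents n)"
    using upset_subset[OF assms] by (rule supported_on_mono)
  show "subgroup (supported_on S) (add_monoid (poly_ring n))"
  proof (rule add.subgroupI)
    fix a assume "a \<in> supported_on S"
    then show "\<ominus>\<^bsub>poly_ring n\<^esub> a \<in> supported_on S"
      using S by (subst a_inv_poly_ring) auto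
  qed (use S in auto)
qed (use ideal_mult_supported_on[OF assms] in auto)

text \<open>Each term of a polynomial supported on the up-closure is a multiple of one generator,
  and the polynomial is the sum of its terms. From here on ideals generated by monomials are
  replaced by sets of exponents.\<close>

lemma genideal_monomials:
  assumes "S \<subseteq> exponents n"
  shows "genideal (poly_ring n) (monomial ` S :: 'k::field mpoly set) = supported_on (up_closure n S)"
proof
  let ?I = "genideal (poly_ring n) (monomial ` S) :: 'k mpoly set"
  interpret cring "poly_ring n :: 'k mpoly ring" by (rule cring_poly_ring)
  have S: "(monomial ` S :: 'k mpoly set) \<subseteq> carrier (poly_ring n)"
    using assms by auto
  show "?I \<subseteq> supported_on (up_closure n S)"
    by (rule genideal_minimal[OF ideal_supported_on[OF upset_up_closure[OF assms]]])
       (use up_closure_superset[of S n] in auto)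
  interpret I: ideal "?I" "poly_ring n"
    by (rule genideal_ideal[OF S])
  show "supported_on (up_closure n S) \<subseteq> ?I"
  proof
    fix f :: "'k mpoly" assume f: "f \<in> supported_on (up_closure n S)"
    have terms: "single m (lookup f m) \<in> ?I" if m: "m \<in> keys f" for m
    proof -
      obtain s w where sw: "m = s + w" "s \<in> S" "w \<in> exponents n"
        using f m unfolding up_closure_def supported_on_iff by blast
      have "single w (lookup f m) * monomial s \<in> ?I"
        using I.I_l_closed[of "monomial s" "single w (lookup f m)"] sw genideal_self[OF S]
        by (auto simp: single_in_supported_on)
      then show ?thesis
        using sw by (simp add: monomial_def mult_single add.commute)
    qed
    have sum_closed: "sum g A \<in> ?I"
      if "\<And>m. m \<in> A \<Longrightarrow> g m \<in> ?I" for g :: "_ \<Rightarrow> 'k mpoly" and A :: "(nat \<Rightarrow>\<^sub>0 nat) set"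
      using that by (induction A rule: infinite_finite_induct) (use I.zero_closed I.a_closed in auto)
    have "(\<Sum>m\<in>keys f. single m (lookup f m)) \<in> ?I"
      by (intro sum_closed terms)
    then show "f \<in> ?I"
      by (simp flip: poly_mapping_eq_sum_single)
  qed
qed

section \<open>Degrees and homogeneous components\<close>

lemma exp_degree_eq_sum:
  assumes "finite A" "keys m \<subseteq> A"
  shows "exp_degree m = (\<Sum>i\<in>A. lookup m i)"
  unfolding exp_degree_def by (rule sum.mono_neutral_left) (use assms in \<open>auto simp: in_keys_iff\<close>)

lemma exp_degree_exponents: "m \<in> exponents n \<Longrightarrow> exp_degree m = (\<Sum>i=1..n. lookup m i)"
  by (rule exp_degree_eq_sum) (auto simp: exponents_def)

lemma exp_degree_add [simp]: "exp_degree (a + b) = exp_degree a + exp_degree b"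
proof -
  have "keys (a + b) \<subseteq> keys a \<union> keys b" by (rule keys_add)
  then show ?thesis
    by (simp add: exp_degree_eq_sum[of "keys a \<union> keys b"] lookup_add sum.distrib)
qed

lemma exp_degree_0 [simp]: "exp_degree 0 = 0"
  by (simp add: exp_degree_def)

lemma exp_degree_single [simp]: "exp_degree (single i k) = k"
  by (simp add: exp_degree_def)

lemma exp_degree_eq_0 [simp]: "exp_degree m = 0 \<longleftrightarrow> m = 0"
  by (auto simp: exp_degree_def in_keys_iff intro!: poly_mapping_eqI)

definition exponents_of_degree :: "nat \<Rightarrow> int \<Rightarrow> (nat \<Rightarrow>\<^sub>0 nat) set" where
  "exponents_of_degree n e = {m \<in> exponents n. int (exp_degree m) = e}"

lemma homogeneous_part_eq: "homogeneous_part n e = supported_on (exponents_of_degree n e)"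
  by (auto simp: homogeneous_part_def supported_on_def exponents_of_degree_def)

lemma homogeneous_part_carrier: "f \<in> homogeneous_part n e \<Longrightarrow> f \<in> supported_on (exponents n)"
  by (auto simp: homogeneous_part_def)

lemma homogeneous_part_mult:
  "f \<in> homogeneous_part n c \<Longrightarrow> g \<in> homogeneous_part n e \<Longrightarrow> f * g \<in> homogeneous_part n (c + e)"
  unfolding homogeneous_part_eq by (rule supported_on_mult) (auto simp: exponents_of_degree_def)

definition homogeneous_component :: "int \<Rightarrow> 'k::field mpoly \<Rightarrow> 'k mpoly" where
  "homogeneous_component e f =
     (\<Sum>m | m \<in> keys f \<and> int (exp_degree m) = e. single m (lookup f m))"

lemma lookup_homogeneous_component:
  "lookup (homogeneous_component e f) m = (if int (exp_degree m) = e then lookup f m else 0)"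
proof -
  have "finite {m. m \<in> keys f \<and> int (exp_degree m) = e}" by simp
  then show ?thesis
    by (auto simp: homogeneous_component_def lookup_sum lookup_single when_def sum.delta in_keys_iff)
qed

lemma keys_homogeneous_component:
  "keys (homogeneous_component e f) = {m \<in> keys f. int (exp_degree m) = e}"
  by (auto simp: in_keys_iff lookup_homogeneous_component split: if_splits)

lemma homogeneous_component_in:
  "f \<in> supported_on (exponents n) \<Longrightarrow> homogeneous_component e f \<in> homogeneous_part n e"
  by (auto simp: homogeneous_part_def keys_homogeneous_component supported_on_def)

lemma homogeneous_component_add:
  "homogeneous_component e (f + g) = homogeneous_component e f + homogeneous_component e g"
  by (rule poly_mapping_eqI) (simp add: lookup_homogeneous_component lookup_add)

lemma homogeneous_component_diff:
  "homogeneous_component e (f - g) = homogeneous_component e f - homogeneous_component e g"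
  by (rule poly_mapping_eqI) (simp add: lookup_homogeneous_component lookup_minus)

lemma homogeneous_component_0 [simp]: "homogeneous_component e 0 = 0"
  by (rule poly_mapping_eqI) (simp add: lookup_homogeneous_component)

lemma homogeneous_component_sum:
  "homogeneous_component e (sum f A) = (\<Sum>i\<in>A. homogeneous_component e (f i))"
  by (induction A rule: infinite_finite_induct) (auto simp: homogeneous_component_add)

lemma homogeneous_component_ident:
  "f \<in> homogeneous_part n e \<Longrightarrow> homogeneous_component c f = (if c = e then f else 0)"
  by (rule poly_mapping_eqI)
     (auto simp: lookup_homogeneous_component homogeneous_part_def in_keys_iff)

text \<open>Split off from \<open>f\<close> its component of degree \<open>c\<close>: as
  \<open>g\<close> is homogeneous of degree \<open>e\<close>, the remaining terms multiplied by
  \<open>g\<close> miss degree \<open>c + e\<close> altogether.\<close>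

lemma homogeneous_component_mult:
  assumes "g \<in> homogeneous_part n e" "f \<in> supported_on (exponents n)"
  shows "homogeneous_component (c + e) (f * g) = homogeneous_component c f * g"
proof -
  let ?h = "homogeneous_component c f"
  have "keys ((f - ?h) * g) \<subseteq> {m. int (exp_degree m) \<noteq> c + e}"
  proof
    fix m assume "m \<in> keys ((f - ?h) * g)"
    then obtain a b where ab: "m = a + b" "a \<in> keys (f - ?h)" "b \<in> keys g"
      using keys_mult[of "f - ?h" g] by blast
    have "int (exp_degree a) \<noteq> c"
      using ab(2) by (auto simp: in_keys_iff lookup_minus lookup_homogeneous_component)
    then show "m \<in> {m. int (exp_degree m) \<noteq> c + e}"
      using ab assms(1) by (auto simp: homogeneous_part_def)
  qed
  then have "homogeneous_component (c + e) ((f - ?h) * g) = 0"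
    by (auto intro!: poly_mapping_eqI simp: lookup_homogeneous_component in_keys_iff)
  moreover have "?h * g \<in> homogeneous_part n (c + e)"
    by (intro homogeneous_part_mult homogeneous_component_in assms)
  ultimately show ?thesis
    using homogeneous_component_add[of "c + e" "(f - ?h) * g" "?h * g"]
    by (simp add: homogeneous_component_ident algebra_simps)
qed

lemma supported_on_homogeneous_component:
  "f \<in> supported_on S \<Longrightarrow> homogeneous_component e f \<in> supported_on S"
  by (auto simp: supported_on_def keys_homogeneous_component)

lemma irrelevant_ideal_eq: "(irrelevant_ideal n :: 'k::field mpoly set) = supported_on (exponents n - {0})"
proof -
  have eq: "(\<lambda>i. monomial (single i 1) :: 'k mpoly) ` {1..n} = monomial ` ((\<lambda>i. single i 1) ` {1..n})"
    by auto
  have "up_closure n ((\<lambda>i. single i 1) ` {1..n}) = exponents n - {0}"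
  proof
    show "up_closure n ((\<lambda>i. single i 1) ` {1..n}) \<subseteq> exponents n - {0}"
    proof
      fix m assume "m \<in> up_closure n ((\<lambda>i. single i 1) ` {1..n})"
      then obtain i w where m: "m = single i 1 + w" "i \<in> {1..n}" "w \<in> exponents n"
        by (auto simp: up_closure_def)
      then have "m \<noteq> 0" by (auto simp flip: exp_degree_eq_0)
      then show "m \<in> exponents n - {0}" using m by (auto intro!: exponents_add exponents_single)
    qed
    show "exponents n - {0} \<subseteq> up_closure n ((\<lambda>i. single i 1) ` {1..n})"
    proof
      fix m assume m: "m \<in> exponents n - {0}"
      then obtain i where i: "i \<in> keys m" by (metis DiffE all_not_in_conv keys_eq_empty singletonI)
      have "m = single i 1 + (m - single i 1)"
        using i by (intro poly_mapping_eqI) (auto simp: lookup_add lookup_minus lookup_single in_keys_iff when_def)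
      moreover have "m - single i 1 \<in> exponents n" "i \<in> {1..n}"
        using m i exponents_diff[of m n] by (auto simp: exponents_def)
      ultimately show "m \<in> up_closure n ((\<lambda>i. single i 1) ` {1..n})"
        unfolding up_closure_def by (intro CollectI exI conjI) (assumption, erule imageI)
    qed
  qed
  moreover have "(\<lambda>i. single i 1) ` {1..n} \<subseteq> exponents n"
    by (intro image_subsetI exponents_single)
  ultimately show ?thesis
    unfolding irrelevant_ideal_def eq by (simp only: genideal_monomials)
qed

section \<open>Free modules\<close>

definition scale :: "'k::field mpoly \<Rightarrow> (nat \<Rightarrow> 'k mpoly) \<Rightarrow> nat \<Rightarrow> 'k mpoly" where
  "scale f v = (\<lambda>j. f * v j)"

text \<open>The carrier of \<open>free_module\<close> freed from its record: addition is the
  pointwise one of functions, so its group laws are available to the simplifier.\<close>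

definition free_vec :: "nat \<Rightarrow> nat \<Rightarrow> (nat \<Rightarrow> 'k::field mpoly) set" where
  "free_vec n r = {v. (\<forall>j<r. v j \<in> supported_on (exponents n)) \<and> (\<forall>j\<ge>r. v j = 0)}"

definition homog_vec :: "nat \<Rightarrow> int list \<Rightarrow> int \<Rightarrow> (nat \<Rightarrow> 'k::field mpoly) set" where
  "homog_vec n as e = {v. (\<forall>j<length as. v j \<in> homogeneous_part n (e - as ! j)) \<and>
                          (\<forall>j\<ge>length as. v j = 0)}"

definition unit_vec :: "nat \<Rightarrow> nat \<Rightarrow> 'k::field mpoly" where
  "unit_vec j = (\<lambda>i. if i = j then 1 else 0)"

lemma scale_apply [simp]: "scale f v j = f * v j"
  by (simp add: scale_def)

lemma sum_fun_apply: "sum f A j = (\<Sum>i\<in>A. f i j)" for f :: "'i \<Rightarrow> 'j \<Rightarrow> 'a::comm_monoid_add"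
  by (induction A rule: infinite_finite_induct) auto

lemma scale_simps [simp]: "scale 0 v = 0" "scale f 0 = 0" "scale 1 v = v"
  "scale f (scale g v) = scale (f * g) v"
  by (auto simp: fun_eq_iff mult.assoc)

lemma scale_distrib: "scale f (v + w) = scale f v + scale f w" "scale (f + g) v = scale f v + scale g v"
  "scale f (v - w) = scale f v - scale f w" "scale f (- v) = - scale f v"
  by (auto simp: fun_eq_iff algebra_simps)

lemma scale_sum: "scale f (sum g A) = (\<Sum>i\<in>A. scale f (g i))"
  by (auto simp: fun_eq_iff sum_fun_apply sum_distrib_left)

lemma free_vec_closed [intro, simp]:
  "0 \<in> free_vec n r"
  "v \<in> free_vec n r \<Longrightarrow> w \<in> free_vec n r \<Longrightarrow> v + w \<in> free_vec n r"
  "v \<in> free_vec n r \<Longrightarrow> w \<in> free_vec n r \<Longrightarrow> v - w \<in> free_vec n r"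
  "v \<in> free_vec n r \<Longrightarrow> - v \<in> free_vec n r"
  "f \<in> supported_on (exponents n) \<Longrightarrow> v \<in> free_vec n r \<Longrightarrow> scale f v \<in> free_vec n r"
  by (auto simp: free_vec_def)

lemma free_vec_sum: "(\<And>i. i \<in> A \<Longrightarrow> g i \<in> free_vec n r) \<Longrightarrow> sum g A \<in> free_vec n r"
  by (induction A rule: infinite_finite_induct) auto

lemma free_vec_nth: "v \<in> free_vec n r \<Longrightarrow> v j \<in> supported_on (exponents n)"
  by (cases "j < r") (auto simp: free_vec_def)

lemma unit_vec_in_free_vec [intro, simp]: "j < r \<Longrightarrow> unit_vec j \<in> free_vec n r"
  by (auto simp: free_vec_def unit_vec_def)

lemma free_vec_eq_sum:
  assumes "v \<in> free_vec n r"
  shows "v = (\<Sum>j<r. scale (v j) (unit_vec j))"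
proof
  fix i
  show "v i = (\<Sum>j<r. scale (v j) (unit_vec j)) i"
    using assms by (auto simp: sum_fun_apply unit_vec_def free_vec_def if_distrib sum.delta cong: if_cong)
qed

lemma homog_vec_subset: "homog_vec n as e \<subseteq> free_vec n (length as)"
  by (auto simp: homog_vec_def free_vec_def intro: homogeneous_part_carrier)

lemma homog_vec_closed:
  "0 \<in> homog_vec n as e"
  "v \<in> homog_vec n as e \<Longrightarrow> w \<in> homog_vec n as e \<Longrightarrow> v + w \<in> homog_vec n as e"
  "v \<in> homog_vec n as e \<Longrightarrow> - v \<in> homog_vec n as e"
  "f \<in> homogeneous_part n c \<Longrightarrow> v \<in> homog_vec n as e \<Longrightarrow> scale f v \<in> homog_vec n as (c + e)"
  using homogeneous_part_mult[of f n c "v j" "e - as ! j" for j]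
  by (auto simp: homog_vec_def homogeneous_part_eq add_diff_eq)

lemma homog_vec_sum: "(\<And>i. i \<in> A \<Longrightarrow> g i \<in> homog_vec n as e) \<Longrightarrow> sum g A \<in> homog_vec n as e"
  by (induction A rule: infinite_finite_induct) (auto intro: homog_vec_closed)

lemma unit_vec_in_homog_vec: "j < length as \<Longrightarrow> unit_vec j \<in> homog_vec n as (as ! j)"
  by (auto simp: homog_vec_def unit_vec_def homogeneous_part_def)

lemma free_module_simps [simp]:
  "carrier (free_module n as) = free_vec n (length as)"
  "zero (free_module n as) = 0"
  "add (free_module n as) = (+)"
  "smult (free_module n as) = scale"
  "component (free_module n as) e = homog_vec n as e"
  by (auto simp: free_module_def free_vec_def homog_vec_def fun_eq_iff)

definition linear_map :: "nat \<Rightarrow> nat \<Rightarrow> nat \<Rightarrow> ((nat \<Rightarrow> 'k::field mpoly) \<Rightarrow> nat \<Rightarrow> 'k mpoly) \<Rightarrow> bool" where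
  "linear_map n r s f \<longleftrightarrow> f \<in> free_vec n r \<rightarrow> free_vec n s \<and>
     (\<forall>v\<in>free_vec n r. \<forall>w\<in>free_vec n r. f (v + w) = f v + f w) \<and>
     (\<forall>c\<in>supported_on (exponents n). \<forall>v\<in>free_vec n r. f (scale c v) = scale c (f v))"

lemma graded_hom_free_module:
  "graded_hom n (free_module n as) (free_module n bs) f \<longleftrightarrow>
     linear_map n (length as) (length bs) f \<and> (\<forall>e. f ` homog_vec n as e \<subseteq> homog_vec n bs e)"
  by (simp add: graded_hom_def linear_map_def)

lemma linear_mapD:
  assumes "linear_map n r s f"
  shows "v \<in> free_vec n r \<Longrightarrow> f v \<in> free_vec n s"
    and "v \<in> free_vec n r \<Longrightarrow> w \<in> free_vec n r \<Longrightarrow> f (v + w) = f v + f w"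
    and "c \<in> supported_on (exponents n) \<Longrightarrow> v \<in> free_vec n r \<Longrightarrow> f (scale c v) = scale c (f v)"
  using assms by (auto simp: linear_map_def)

lemma linear_map_0: "linear_map n r s f \<Longrightarrow> f 0 = 0"
  using linear_mapD(3)[of n r s f 0 0] by simp

lemma linear_map_uminus: "linear_map n r s f \<Longrightarrow> v \<in> free_vec n r \<Longrightarrow> f (- v) = - f v"
  using linear_mapD(2)[of n r s f v "- v"] linear_map_0[of n r s f]
  by (simp add: minus_unique)

lemma linear_map_diff:
  "linear_map n r s f \<Longrightarrow> v \<in> free_vec n r \<Longrightarrow> w \<in> free_vec n r \<Longrightarrow> f (v - w) = f v - f w"
  using linear_mapD(2)[of n r s f v "- w"] linear_map_uminus[of n r s f w] by simp

lemma linear_map_sum: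
  assumes "linear_map n r s f" "\<And>i. i \<in> A \<Longrightarrow> g i \<in> free_vec n r"
  shows "f (sum g A) = (\<Sum>i\<in>A. f (g i))"
  using assms(2)
  by (induction A rule: infinite_finite_induct)
     (auto simp: linear_map_0[OF assms(1)] linear_mapD(2)[OF assms(1)] free_vec_sum)

lemma linear_map_expand:
  assumes "linear_map n r s f" "v \<in> free_vec n r"
  shows "f v = (\<Sum>j<r. scale (v j) (f (unit_vec j)))"
proof -
  have "f v = f (\<Sum>j<r. scale (v j) (unit_vec j))"
    using free_vec_eq_sum[OF assms(2)] by simp
  also have "\<dots> = (\<Sum>j<r. scale (v j) (f (unit_vec j)))"
    using free_vec_nth[OF assms(2)] linear_mapD(3)[OF assms(1)]
    by (subst linear_map_sum[OF assms(1)]) auto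
  finally show ?thesis .
qed

lemma linear_map_compose:
  "linear_map n r s f \<Longrightarrow> linear_map n s t g \<Longrightarrow> linear_map n r t (\<lambda>v. g (f v))"
  by (auto simp: linear_map_def Pi_iff)

lemma linear_map_add:
  "linear_map n r s f \<Longrightarrow> linear_map n r s g \<Longrightarrow> linear_map n r s (\<lambda>v. f v + g v)"
  by (auto simp: linear_map_def Pi_iff scale_distrib)

lemma linear_map_minus:
  "linear_map n r s f \<Longrightarrow> linear_map n r s g \<Longrightarrow> linear_map n r s (\<lambda>v. f v - g v)"
  by (auto simp: linear_map_def Pi_iff scale_distrib)

lemma linear_map_ident: "linear_map n r r (\<lambda>v. v)"
  by (auto simp: linear_map_def)

text \<open>Lifting through a surjection, comparison over a common quotient and lifting in a prescribed
  degree are all instances, for suitable relations \<open>R\<close>.\<close>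

lemma linear_map_lift:
  assumes add: "\<And>v w v' w'. (v, w) \<in> R \<Longrightarrow> (v', w') \<in> R \<Longrightarrow> (v + v', w + w') \<in> R"
    and smult: "\<And>c v w. c \<in> supported_on (exponents n) \<Longrightarrow> (v, w) \<in> R \<Longrightarrow> (scale c v, scale c w) \<in> R"
    and zero: "(0, 0) \<in> R"
    and basis: "\<And>j. j < r \<Longrightarrow> \<exists>w\<in>W j. (unit_vec j, w) \<in> R"
    and W: "\<And>j. j < r \<Longrightarrow> W j \<subseteq> free_vec n s"
  obtains \<phi> where "linear_map n r s \<phi>" "\<And>v. v \<in> free_vec n r \<Longrightarrow> (v, \<phi> v) \<in> R"
    "\<And>j. j < r \<Longrightarrow> \<phi> (unit_vec j) \<in> W j"
proof -
  obtain w where w: "\<And>j. j < r \<Longrightarrow> w j \<in> W j \<and> (unit_vec j, w j) \<in> R"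
    using basis by metis
  define \<phi> where "\<phi> v = (\<Sum>j<r. scale (v j) (w j))" for v :: "nat \<Rightarrow> 'a mpoly"
  have wV: "w j \<in> free_vec n s" if "j < r" for j
    using w W that by blast
  have lin: "linear_map n r s \<phi>"
    unfolding linear_map_def \<phi>_def
    by (auto simp: scale_distrib sum.distrib scale_sum wV free_vec_nth intro!: free_vec_sum)
  have rel: "(v, \<phi> v) \<in> R" if v: "v \<in> free_vec n r" for v
  proof -
    \<comment> \<open>\<open>R\<close> is closed under binary sums and scaling, so the relation is
      carried along the partial sums of the basis expansion of \<open>v\<close>.\<close>
    have "k \<le> r \<Longrightarrow> ((\<Sum>j<k. scale (v j) (unit_vec j)), (\<Sum>j<k. scale (v j) (w j))) \<in> R" for k
      by (induction k) (use zero add smult w free_vec_nth[OF v] in auto)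
    from this[of r] show ?thesis
      using free_vec_eq_sum[OF v] by (simp add: \<phi>_def)
  qed
  have "\<phi> (unit_vec j) = w j" if "j < r" for j
  proof -
    have "\<phi> (unit_vec j) = (\<Sum>i<r. if i = j then w i else 0)"
      unfolding \<phi>_def by (rule sum.cong) (auto simp: unit_vec_def)
    then show ?thesis using that by simp
  qed
  then show ?thesis using that[OF lin rel] w by simp
qed

section \<open>Uniqueness of the ranks of a minimal resolution\<close>

text \<open>The identity matrix of size \<open>r\<close> factors through \<open>k^s\<close>, so its
  \<open>r\<close> independent columns lie in the span of the \<open>s\<close> columns of
  \<open>d\<close>.\<close>

lemma matrix_left_inverse_le:
  fixes c d :: "nat \<Rightarrow> nat \<Rightarrow> 'k::field"
  assumes "\<And>i j. i < r \<Longrightarrow> j < r \<Longrightarrow> (\<Sum>l<s. d i l * c l j) = (if i = j then 1 else 0)"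
  shows "r \<le> s"
proof -
  interpret V: vector_space "\<lambda>a (f :: nat \<Rightarrow> 'k) i. a * f i"
    by standard (auto simp: fun_eq_iff algebra_simps)
  define u where "u j = (\<lambda>i. if i = j then 1 else 0 :: 'k)" for j :: nat
  \<comment> \<open>The ambient space consists of functions on all of \<open>nat\<close>, and the
    hypothesis controls only rows below \<open>r\<close>; truncating the columns makes the expansion
    of \<open>u j\<close> valid at every index.\<close>
  define D where "D l = (\<lambda>i. if i < r then d i l else 0)" for l
  have inj: "inj_on u A" for A
    by (rule inj_onI) (auto simp: u_def fun_eq_iff split: if_splits)
  have "V.independent (u ` {..<r})"
    unfolding V.independent_explicit_module
  proof (intro allI impI)
    fix t and x :: "(nat \<Rightarrow> 'k) \<Rightarrow> 'k" and v
    assume t: "finite t" "t \<subseteq> u ` {..<r}" "(\<Sum>v\<in>t. (\<lambda>i. x v * v i)) = 0" "v \<in> t"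
    then obtain j where j: "v = u j" by blast
    have "0 = (\<Sum>w\<in>t. x w * w j)"
      using t(3) by (simp add: fun_eq_iff sum_fun_apply)
    also have "\<dots> = (\<Sum>w\<in>t. if w = v then x v else 0)"
    proof (rule sum.cong)
      fix w assume "w \<in> t"
      then obtain i where i: "w = u i" using t by blast
      have "w j = (if i = j then 1 else 0)" by (simp add: i u_def)
      moreover have "w = v \<longleftrightarrow> i = j" using inj_eq[OF inj[of UNIV]] by (simp add: i j)
      ultimately show "x w * w j = (if w = v then x v else 0)" by auto
    qed simp
    also have "\<dots> = x v" using t by simp
    finally show "x v = 0" by simp
  qed
  moreover have "u ` {..<r} \<subseteq> V.span (D ` {..<s})"
  proof (rule image_subsetI)
    fix j assume j: "j \<in> {..<r}"
    have "u j = (\<Sum>l<s. (\<lambda>i. c l j * D l i))"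
    proof
      fix i
      show "u j i = (\<Sum>l<s. (\<lambda>i. c l j * D l i)) i"
        using assms[of i j] j by (cases "i < r") (auto simp: sum_fun_apply u_def D_def mult.commute)
    qed
    then show "u j \<in> V.span (D ` {..<s})"
      by (simp only:) (intro V.span_sum V.span_scale V.span_base imageI)
  qed
  ultimately have "card (u ` {..<r}) \<le> card (D ` {..<s})"
    by (intro conjunct2[OF V.independent_span_bound]) auto
  also have "\<dots> \<le> s" using card_image_le[of "{..<s}" D] by simp
  finally show ?thesis by (simp add: card_image inj)
qed

text \<open>Taking the constant term is reduction modulo the irrelevant ideal: the exponent
  \<open>0\<close> is a sum of two exponents only as \<open>0 + 0\<close>.\<close>

lemma lookup_mult_0: "lookup (f * g) 0 = lookup f 0 * lookup g 0" for f g :: "'k::field mpoly"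
proof -
  have 1: "lookup (f' * g') 0 = 0" if "lookup f' 0 = 0" for f' g' :: "'k mpoly"
  proof -
    have "0 \<notin> keys (f' * g')"
    proof
      assume "0 \<in> keys (f' * g')"
      then obtain a b where "0 = a + b" "a \<in> keys f'" using keys_mult[of f' g'] by blast
      moreover from this have "exp_degree a = 0" using exp_degree_add[of a b] by simp
      ultimately show False using that by (simp add: in_keys_iff)
    qed
    then show ?thesis by (simp add: in_keys_iff)
  qed
  let ?f = "single 0 (lookup f 0) :: 'k mpoly" and ?g = "single 0 (lookup g 0) :: 'k mpoly"
  have "f * g = (f - ?f) * g + (g - ?g) * ?f + ?f * ?g"
    by (simp add: algebra_simps)
  then have "lookup (f * g) 0 = lookup (?f * ?g) 0"
    using 1[of "f - ?f" g] 1[of "g - ?g" ?f] by (simp add: lookup_add lookup_minus)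
  then show ?thesis by (simp add: mult_single)
qed

lemma irrelevant_ideal_iff:
  "f \<in> irrelevant_ideal n \<longleftrightarrow> f \<in> supported_on (exponents n) \<and> lookup f 0 = 0"
  by (auto simp: irrelevant_ideal_eq supported_on_def in_keys_iff subset_iff)

lemma upset_nonzero: "upset n (exponents n - {0})"
  unfolding upset_def by (auto dest: arg_cong[of _ _ exp_degree])

lemma irrelevant_ideal_closed:
  "f \<in> irrelevant_ideal n \<Longrightarrow> g \<in> irrelevant_ideal n \<Longrightarrow> f + g \<in> irrelevant_ideal n"
  "f \<in> irrelevant_ideal n \<Longrightarrow> g \<in> supported_on (exponents n) \<Longrightarrow> f * g \<in> irrelevant_ideal n"
  "(\<And>i. i \<in> A \<Longrightarrow> h i \<in> irrelevant_ideal n) \<Longrightarrow> sum h A \<in> irrelevant_ideal n"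
  by (auto simp: irrelevant_ideal_eq intro: supported_on_sum ideal_mult_supported_on[OF upset_nonzero])

text \<open>What is left of a minimal resolution after forgetting the augmentation and the grading.
  The induction on the homological degree takes place here; the module enters at degree 0
  alone.\<close>

definition minimal_complex ::
  "nat \<Rightarrow> (nat \<Rightarrow> nat) \<Rightarrow> (nat \<Rightarrow> (nat \<Rightarrow> 'k::field mpoly) \<Rightarrow> (nat \<Rightarrow> 'k mpoly)) \<Rightarrow> bool" where
  "minimal_complex n r \<delta> \<longleftrightarrow>
     (\<forall>p. linear_map n (r (Suc p)) (r p) (\<delta> p)) \<and>
     (\<forall>p. {v \<in> free_vec n (r (Suc p)). \<delta> p v = 0} = \<delta> (Suc p) ` free_vec n (r (Suc (Suc p)))) \<and>
     (\<forall>p. \<forall>v\<in>free_vec n (r (Suc p)). \<forall>j<r p. \<delta> p v j \<in> irrelevant_ideal n)"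

text \<open>Projectivity of free modules. It produces the comparison maps in both directions as well
  as the homotopy.\<close>

lemma linear_map_lift_surj:
  assumes lin: "linear_map n t r' \<delta>'" and g: "linear_map n s r g"
    and im: "\<And>v. v \<in> free_vec n s \<Longrightarrow> g v \<in> \<delta>' ` free_vec n t"
  obtains \<phi> where "linear_map n s t \<phi>" "\<And>v. v \<in> free_vec n s \<Longrightarrow> \<delta>' (\<phi> v) = g v"
proof -
  define R where "R = {(v, w). v \<in> free_vec n s \<and> w \<in> free_vec n t \<and> \<delta>' w = g v}"
  obtain \<phi> where "linear_map n s t \<phi>" "\<And>v. v \<in> free_vec n s \<Longrightarrow> (v, \<phi> v) \<in> R"
  proof (rule linear_map_lift[of R n s "\<lambda>_. free_vec n t" t])
    fix j assume "j < s"
    then show "\<exists>w\<in>free_vec n t. (unit_vec j, w) \<in> R"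
      using im[of "unit_vec j"] by (force simp: R_def)
  qed (auto simp: R_def linear_mapD[OF lin] linear_mapD[OF g] linear_map_0[OF lin] linear_map_0[OF g])
  then show ?thesis by (intro that) (auto simp: R_def)
qed

text \<open>The comparison maps \<open>\<phi>\<close> and \<open>\<psi>\<close> between two minimal resolutions, together with the part \<open>u\<close>
  of \<open>\<psi> \<phi> - 1\<close> that is left after subtracting \<open>h \<delta>\<close> for the homotopy \<open>h\<close> in the previous degree.
  Since \<open>h \<delta>\<close> and \<open>u\<close> take values in \<open>\<mm> F\<^sub>p\<close>, \<open>\<phi>\<close> has a left inverse modulo \<open>\<mm>\<close>.\<close>

definition comparison ::
  "nat \<Rightarrow> nat \<Rightarrow> nat \<Rightarrow> (nat \<Rightarrow> 'k::field mpoly) set \<Rightarrow> (nat \<Rightarrow> 'k mpoly) set \<Rightarrow>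
   ((nat \<Rightarrow> 'k mpoly) \<Rightarrow> (nat \<Rightarrow> 'k mpoly)) \<Rightarrow> ((nat \<Rightarrow> 'k mpoly) \<Rightarrow> (nat \<Rightarrow> 'k mpoly)) \<Rightarrow>
   ((nat \<Rightarrow> 'k mpoly) \<Rightarrow> (nat \<Rightarrow> 'k mpoly)) \<Rightarrow> bool" where
  "comparison n r r' Z Z' \<phi> \<psi> u \<longleftrightarrow>
     linear_map n r r' \<phi> \<and> linear_map n r' r \<psi> \<and> linear_map n r r u \<and>
     \<phi> ` Z \<subseteq> Z' \<and> \<psi> ` Z' \<subseteq> Z \<and> u ` free_vec n r \<subseteq> Z \<and>
     (\<forall>z\<in>Z. u z = \<psi> (\<phi> z) - z) \<and>
     (\<forall>v\<in>free_vec n r. \<forall>j<r. (\<psi> (\<phi> v) - v) j \<in> irrelevant_ideal n)"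

text \<open>Modulo the irrelevant ideal \<open>\<psi>\<close> is a left inverse of
  \<open>\<phi>\<close>, so the matrices of constant terms satisfy
  \<open>matrix_left_inverse_le\<close>.\<close>

lemma comparison_rank_le:
  assumes "comparison n r r' Z Z' \<phi> \<psi> u"
  shows "r \<le> r'"
proof (rule matrix_left_inverse_le)
  fix i j assume ij: "i < r" "j < r"
  have \<phi>: "linear_map n r r' \<phi>" and \<psi>: "linear_map n r' r \<psi>"
    using assms by (auto simp: comparison_def)
  have "lookup ((\<psi> (\<phi> (unit_vec j)) - unit_vec j) i) 0 = 0"
    using assms ij unfolding comparison_def irrelevant_ideal_iff by blast
  then have "lookup (\<psi> (\<phi> (unit_vec j)) i) 0 = (if i = j then 1 else 0)"
    by (simp add: lookup_minus unit_vec_def split: if_splits)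
  moreover have "\<psi> (\<phi> (unit_vec j)) i = (\<Sum>l<r'. \<phi> (unit_vec j) l * \<psi> (unit_vec l) i)"
    using linear_map_expand[OF \<psi> linear_mapD(1)[OF \<phi> unit_vec_in_free_vec[OF ij(2)]]]
    by (simp add: sum_fun_apply)
  ultimately show "(\<Sum>l<r'. lookup (\<psi> (unit_vec l) i) 0 * lookup (\<phi> (unit_vec j) l) 0)
      = (if i = j then 1 else 0)"
    by (simp add: lookup_sum lookup_mult_0 mult.commute)
qed

text \<open>The error \<open>\<psi>' \<phi>' - 1\<close> is written as
  \<open>u' + h \<delta>\<close>. The values of the first summand are cycles, which by exactness are
  boundaries and by minimality have entries in the irrelevant ideal; the second summand has such
  entries because \<open>\<delta> p\<close> does.\<close>

lemma comparison_step:
  assumes C: "minimal_complex n r \<delta>" and C': "minimal_complex n r' \<delta>'"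
    and "comparison n (r p) (r' p) (\<delta> p ` free_vec n (r (Suc p))) (\<delta>' p ` free_vec n (r' (Suc p))) \<phi> \<psi> u"
  shows "\<exists>\<phi> \<psi> u. comparison n (r (Suc p)) (r' (Suc p))
     (\<delta> (Suc p) ` free_vec n (r (Suc (Suc p)))) (\<delta>' (Suc p) ` free_vec n (r' (Suc (Suc p)))) \<phi> \<psi> u"
proof -
  let ?F = "free_vec n (r p) :: (nat \<Rightarrow> 'a mpoly) set" and ?G = "free_vec n (r (Suc p)) :: (nat \<Rightarrow> 'a mpoly) set"
  let ?F' = "free_vec n (r' p) :: (nat \<Rightarrow> 'a mpoly) set" and ?G' = "free_vec n (r' (Suc p)) :: (nat \<Rightarrow> 'a mpoly) set"
  note \<delta> = C[unfolded minimal_complex_def, THEN conjunct1, rule_format, of p]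
  note \<delta>' = C'[unfolded minimal_complex_def, THEN conjunct1, rule_format, of p]
  have Z: "\<delta> (Suc p) ` free_vec n (r (Suc (Suc p))) = {v \<in> ?G. \<delta> p v = 0}"
    and Z': "\<delta>' (Suc p) ` free_vec n (r' (Suc (Suc p))) = {v \<in> ?G'. \<delta>' p v = 0}"
    using C C' by (simp_all add: minimal_complex_def)
  have min: "\<delta> p v j \<in> irrelevant_ideal n" if "v \<in> ?G" "j < r p" for v j
    using C that by (simp add: minimal_complex_def)
  have minZ: "v j \<in> irrelevant_ideal n" if "v \<in> ?G" "\<delta> p v = 0" "j < r (Suc p)" for v j
  proof -
    have "v \<in> \<delta> (Suc p) ` free_vec n (r (Suc (Suc p)))" using that Z by blast
    then show ?thesis using C that(3) by (auto simp: minimal_complex_def)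
  qed
  have \<phi>: "linear_map n (r p) (r' p) \<phi>" and \<psi>: "linear_map n (r' p) (r p) \<psi>"
    and u: "linear_map n (r p) (r p) u"
    and im: "\<And>v. v \<in> ?G \<Longrightarrow> \<phi> (\<delta> p v) \<in> \<delta>' p ` ?G'" "\<And>v. v \<in> ?G' \<Longrightarrow> \<psi> (\<delta>' p v) \<in> \<delta> p ` ?G"
      "\<And>v. v \<in> ?F \<Longrightarrow> u v \<in> \<delta> p ` ?G"
    and uZ: "\<And>v. v \<in> ?G \<Longrightarrow> u (\<delta> p v) = \<psi> (\<phi> (\<delta> p v)) - \<delta> p v"
    using assms(3) unfolding comparison_def by blast+
  obtain \<phi>' where \<phi>': "linear_map n (r (Suc p)) (r' (Suc p)) \<phi>'" "\<And>v. v \<in> ?G \<Longrightarrow> \<delta>' p (\<phi>' v) = \<phi> (\<delta> p v)"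
    using linear_map_lift_surj[OF \<delta>' linear_map_compose[OF \<delta> \<phi>] im(1)] by blast
  obtain \<psi>' where \<psi>': "linear_map n (r' (Suc p)) (r (Suc p)) \<psi>'" "\<And>v. v \<in> ?G' \<Longrightarrow> \<delta> p (\<psi>' v) = \<psi> (\<delta>' p v)"
    using linear_map_lift_surj[OF \<delta> linear_map_compose[OF \<delta>' \<psi>] im(2)] by blast
  obtain h where h: "linear_map n (r p) (r (Suc p)) h" "\<And>v. v \<in> ?F \<Longrightarrow> \<delta> p (h v) = u v"
    using linear_map_lift_surj[OF \<delta> u im(3)] by blast
  \<comment> \<open>Subtracting the homotopy term makes \<open>\<delta> p (u' v)\<close> vanish,
    since \<open>\<delta> p (h (\<delta> p v)) = u (\<delta> p v)\<close> is the previous error on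
    boundaries. On cycles the term is \<open>0\<close>, so there \<open>u'\<close> is the full error
    again.\<close>
  define u' where "u' v = \<psi>' (\<phi>' v) - v - h (\<delta> p v)" for v
  note comp = linear_map_compose[OF \<phi>'(1) \<psi>'(1)]
  have u': "linear_map n (r (Suc p)) (r (Suc p)) u'"
    unfolding u'_def
    by (intro linear_map_minus linear_map_ident comp linear_map_compose[OF \<delta> h(1)])
  have \<delta>u': "\<delta> p (u' v) = 0" if "v \<in> ?G" for v
    using that comp[THEN linear_mapD(1)] \<phi>'(1)[THEN linear_mapD(1)] h(1)[THEN linear_mapD(1)] \<delta>[THEN linear_mapD(1)]
    by (simp add: u'_def linear_map_diff[OF \<delta>] \<psi>'(2) \<phi>'(2) h(2) uZ)
  have "(\<psi>' (\<phi>' v) - v) j \<in> irrelevant_ideal n" if v: "v \<in> ?G" and j: "j < r (Suc p)" for v j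
  proof -
    have "h (\<delta> p v) j = (\<Sum>i<r p. \<delta> p v i * h (unit_vec i) j)"
      using linear_map_expand[OF h(1) linear_mapD(1)[OF \<delta> v]] by (simp add: sum_fun_apply)
    also have "\<dots> \<in> irrelevant_ideal n"
      using linear_mapD(1)[OF h(1)] by (auto intro!: irrelevant_ideal_closed min v free_vec_nth)
    finally have "u' v j + h (\<delta> p v) j \<in> irrelevant_ideal n"
      using minZ[OF linear_mapD(1)[OF u' v] \<delta>u'[OF v] j] by (intro irrelevant_ideal_closed)
    then show ?thesis by (simp add: u'_def)
  qed
  moreover have "u' v \<in> ?G" if "v \<in> ?G" for v
    using linear_mapD(1)[OF u' that] .
  moreover have "u' v = \<psi>' (\<phi>' v) - v" if "\<delta> p v = 0" for v
    by (simp add: u'_def that linear_map_0[OF h(1)])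
  ultimately have "comparison n (r (Suc p)) (r' (Suc p)) {v \<in> ?G. \<delta> p v = 0} {v \<in> ?G'. \<delta>' p v = 0} \<phi>' \<psi>' u'"
    unfolding comparison_def using \<phi>' \<psi>' u' \<delta>u'
    by (auto simp: linear_mapD linear_map_0[OF \<phi>] linear_map_0[OF \<psi>])
  then show ?thesis unfolding Z Z' by blast
qed

lemma minimal_graded_free_resolution_complex:
  assumes "minimal_graded_free_resolution n M as \<delta> \<epsilon>"
  shows "minimal_complex n (\<lambda>p. length (as p)) \<delta>"
  using assms
  by (auto simp: minimal_graded_free_resolution_def graded_free_resolution_def Let_def
      graded_hom_free_module minimal_complex_def a_kernel_def kernel_def)

lemma resolution_augmentation:
  assumes "graded_free_resolution n M as \<delta> \<epsilon>"
  shows "Module.module (poly_ring n) M"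
    and "graded_hom n (free_module n (as 0)) M \<epsilon>"
    and "\<epsilon> ` free_vec n (length (as 0)) = carrier M"
    and "\<delta> 0 ` free_vec n (length (as 1)) = {v \<in> free_vec n (length (as 0)). \<epsilon> v = \<zero>\<^bsub>M\<^esub>}"
  using assms by (auto simp: graded_free_resolution_def Let_def graded_module_def a_kernel_def kernel_def)

lemma augmentationD:
  assumes "graded_free_resolution n M as \<delta> \<epsilon>"
  shows "v \<in> free_vec n (length (as 0)) \<Longrightarrow> \<epsilon> v \<in> carrier M"
    and "v \<in> free_vec n (length (as 0)) \<Longrightarrow> w \<in> free_vec n (length (as 0)) \<Longrightarrow>
      \<epsilon> (v + w) = \<epsilon> v \<oplus>\<^bsub>M\<^esub> \<epsilon> w"
    and "c \<in> supported_on (exponents n) \<Longrightarrow> v \<in> free_vec n (length (as 0)) \<Longrightarrow>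
      \<epsilon> (scale c v) = c \<odot>\<^bsub>M\<^esub> \<epsilon> v"
  using resolution_augmentation(2)[OF assms] by (auto simp: graded_hom_def)

lemma augmentation_0:
  assumes "graded_free_resolution n M as \<delta> \<epsilon>"
  shows "\<epsilon> 0 = \<zero>\<^bsub>M\<^esub>"
proof -
  interpret M: Module.module "poly_ring n" M by (rule resolution_augmentation(1)[OF assms])
  show ?thesis
    using augmentationD(3)[OF assms, of 0 0] M.smult_l_null[of "\<epsilon> 0"] augmentationD(1)[OF assms, of 0]
    by simp
qed

text \<open>Lifting through a surjection once more; the common target is now an arbitrary module
  given by record operations, so the general \<open>linear_map_lift\<close> is instantiated
  directly.\<close>

lemma augmentation_lift:
  fixes M :: "('k::field mpoly, 'b) gmodule"
  assumes A: "graded_free_resolution n M as \<delta> \<epsilon>" and B: "graded_free_resolution n M bs \<delta>' \<epsilon>'"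
  obtains \<phi> where "linear_map n (length (as 0)) (length (bs 0)) \<phi>"
    "\<And>v. v \<in> free_vec n (length (as 0)) \<Longrightarrow> \<epsilon>' (\<phi> v) = \<epsilon> v"
proof -
  let ?F = "free_vec n (length (as 0)) :: (nat \<Rightarrow> 'k mpoly) set"
  let ?F' = "free_vec n (length (bs 0)) :: (nat \<Rightarrow> 'k mpoly) set"
  define R where "R = {(v, w). v \<in> ?F \<and> w \<in> ?F' \<and> \<epsilon>' w = \<epsilon> v}"
  note \<epsilon> = augmentationD[OF A] augmentation_0[OF A] and \<epsilon>' = augmentationD[OF B] augmentation_0[OF B]
  obtain \<phi> where "linear_map n (length (as 0)) (length (bs 0)) \<phi>" "\<And>v. v \<in> ?F \<Longrightarrow> (v, \<phi> v) \<in> R"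
  proof (rule linear_map_lift[of R n "length (as 0)" "\<lambda>_. ?F'" "length (bs 0)"])
    fix j assume j: "j < length (as 0)"
    then have "\<epsilon> (unit_vec j) \<in> carrier M" by (intro \<epsilon> unit_vec_in_free_vec)
    then obtain w where "w \<in> ?F'" "\<epsilon>' w = \<epsilon> (unit_vec j)"
      using resolution_augmentation(3)[OF B] by (metis image_iff)
    then show "\<exists>w\<in>?F'. (unit_vec j, w) \<in> R"
      using j by (auto simp: R_def)
  qed (auto simp: R_def \<epsilon> \<epsilon>')
  then show ?thesis by (intro that) (auto simp: R_def)
qed

text \<open>At the bottom the homotopy is zero: \<open>\<psi> \<phi> - 1\<close> is annihilated by
  \<open>\<epsilon>\<close>, hence takes values in the image of \<open>\<delta> 0\<close>.\<close>

lemma comparison_augmentation: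
  fixes M :: "('k::field mpoly, 'b) gmodule"
  assumes A: "minimal_graded_free_resolution n M as \<delta> \<epsilon>"
    and B: "minimal_graded_free_resolution n M bs \<delta>' \<epsilon>'"
  shows "\<exists>\<phi> \<psi> u. comparison n (length (as 0)) (length (bs 0))
     (\<delta> 0 ` free_vec n (length (as 1))) (\<delta>' 0 ` free_vec n (length (bs 1))) \<phi> \<psi> u"
proof -
  have A': "graded_free_resolution n M as \<delta> \<epsilon>" and B': "graded_free_resolution n M bs \<delta>' \<epsilon>'"
    using A B by (simp_all add: minimal_graded_free_resolution_def)
  interpret M: Module.module "poly_ring n" M by (rule resolution_augmentation(1)[OF A'])
  let ?F = "free_vec n (length (as 0)) :: (nat \<Rightarrow> 'k mpoly) set"
  let ?F' = "free_vec n (length (bs 0)) :: (nat \<Rightarrow> 'k mpoly) set"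
  note \<epsilon> = augmentationD[OF A']
  note Z = resolution_augmentation(4)[OF A'] and Z' = resolution_augmentation(4)[OF B']
  obtain \<phi> where \<phi>: "linear_map n (length (as 0)) (length (bs 0)) \<phi>" "\<And>v. v \<in> ?F \<Longrightarrow> \<epsilon>' (\<phi> v) = \<epsilon> v"
    using augmentation_lift[OF A' B'] by blast
  obtain \<psi> where \<psi>: "linear_map n (length (bs 0)) (length (as 0)) \<psi>" "\<And>v. v \<in> ?F' \<Longrightarrow> \<epsilon> (\<psi> v) = \<epsilon>' v"
    using augmentation_lift[OF B' A'] by blast
  define u where "u v = \<psi> (\<phi> v) - v" for v
  have u: "linear_map n (length (as 0)) (length (as 0)) u"
    unfolding u_def by (intro linear_map_minus linear_map_ident linear_map_compose[OF \<phi>(1) \<psi>(1)])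
  have \<epsilon>u: "\<epsilon> (u v) = \<zero>\<^bsub>M\<^esub>" if v: "v \<in> ?F" for v
  proof -
    have "\<epsilon> (\<psi> (\<phi> v)) = \<epsilon> (u v + v)" by (simp add: u_def)
    also have "\<dots> = \<epsilon> (u v) \<oplus>\<^bsub>M\<^esub> \<epsilon> v" using \<epsilon>(2) v linear_mapD(1)[OF u v] by blast
    finally have "\<epsilon> v = \<epsilon> (u v) \<oplus>\<^bsub>M\<^esub> \<epsilon> v"
      using \<phi>(2)[OF v] \<psi>(2)[OF linear_mapD(1)[OF \<phi>(1) v]] by simp
    moreover have "\<epsilon> v \<in> carrier M" "\<epsilon> (u v) \<in> carrier M" using \<epsilon>(1) v linear_mapD(1)[OF u v] by blast+
    ultimately show ?thesis by (metis M.add.l_cancel_one' M.add.m_comm)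
  qed
  have "u v j \<in> irrelevant_ideal n" if v: "v \<in> ?F" and j: "j < length (as 0)" for v j
  proof -
    have "u v \<in> \<delta> 0 ` free_vec n (length (as 1))"
      unfolding Z using linear_mapD(1)[OF u v] \<epsilon>u[OF v] by simp
    then show ?thesis using A j by (auto simp: minimal_graded_free_resolution_def)
  qed
  then have "comparison n (length (as 0)) (length (bs 0)) {v \<in> ?F. \<epsilon> v = \<zero>\<^bsub>M\<^esub>} {v \<in> ?F'. \<epsilon>' v = \<zero>\<^bsub>M\<^esub>} \<phi> \<psi> u"
    unfolding comparison_def using \<phi> \<psi> u \<epsilon>u by (auto simp: linear_mapD) (auto simp: u_def)
  then show ?thesis unfolding Z Z' by blast
qed

lemma minimal_resolution_rank_le:
  assumes A: "minimal_graded_free_resolution n M as \<delta> \<epsilon>"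
    and B: "minimal_graded_free_resolution n M bs \<delta>' \<epsilon>'"
  shows "length (as p) \<le> length (bs p)"
proof -
  have "\<exists>\<phi> \<psi> u. comparison n (length (as p)) (length (bs p))
     (\<delta> p ` free_vec n (length (as (Suc p)))) (\<delta>' p ` free_vec n (length (bs (Suc p)))) \<phi> \<psi> u"
  proof (induction p)
    case 0
    then show ?case using comparison_augmentation[OF A B] by simp
  next
    case (Suc p)
    then show ?case
      using comparison_step[OF minimal_graded_free_resolution_complex[OF A]
          minimal_graded_free_resolution_complex[OF B]] by blast
  qed
  then show ?thesis using comparison_rank_le by blast
qed

text \<open>The rank inequality in both directions gives the uniqueness that the definite
  description demands.\<close>

lemma betti_eqI:
  assumes "minimal_graded_free_resolution n M as \<delta> \<epsilon>"
  shows "betti n M p = length (as p)"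
  unfolding betti_def
  by (rule the_equality) (use assms minimal_resolution_rank_le in \<open>blast intro: antisym\<close>)+

section \<open>Graded maps and mapping cones\<close>

definition graded_map ::
  "nat \<Rightarrow> int list \<Rightarrow> int list \<Rightarrow> ((nat \<Rightarrow> 'k::field mpoly) \<Rightarrow> nat \<Rightarrow> 'k mpoly) \<Rightarrow> bool" where
  "graded_map n as bs f \<longleftrightarrow> linear_map n (length as) (length bs) f \<and>
     (\<forall>e. f ` homog_vec n as e \<subseteq> homog_vec n bs e)"

lemma graded_mapD:
  assumes "graded_map n as bs f"
  shows "linear_map n (length as) (length bs) f"
    and "v \<in> homog_vec n as e \<Longrightarrow> f v \<in> homog_vec n bs e"
  using assms by (auto simp: graded_map_def)

lemma graded_map_intro:
  assumes "linear_map n (length as) (length bs) f"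
    and "\<And>e v. v \<in> homog_vec n as e \<Longrightarrow> f v \<in> homog_vec n bs e"
  shows "graded_map n as bs f"
  using assms by (auto simp: graded_map_def)

lemma graded_mapI:
  assumes f: "linear_map n (length as) (length bs) f"
    and basis: "\<And>j. j < length as \<Longrightarrow> f (unit_vec j) \<in> homog_vec n bs (as ! j)"
  shows "graded_map n as bs f"
  unfolding graded_map_def
proof (intro conjI allI f image_subsetI)
  fix e and v :: "nat \<Rightarrow> 'a mpoly" assume v: "v \<in> homog_vec n as e"
  have "scale (v j) (f (unit_vec j)) \<in> homog_vec n bs e" if "j < length as" for j
  proof -
    have "v j \<in> homogeneous_part n (e - as ! j)" using v that by (simp add: homog_vec_def)
    from homog_vec_closed(4)[OF this basis[OF that]] show ?thesis by simp
  qed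
  then show "f v \<in> homog_vec n bs e"
    using v homog_vec_subset[of n as e] by (subst linear_map_expand[OF f]) (auto intro!: homog_vec_sum)
qed

lemma graded_map_compose:
  "graded_map n as bs f \<Longrightarrow> graded_map n bs cs g \<Longrightarrow> graded_map n as cs (\<lambda>v. g (f v))"
  by (intro graded_map_intro linear_map_compose[of n "length as" "length bs" f "length cs" g])
     (auto dest: graded_mapD)

lemma graded_map_add:
  "graded_map n as bs f \<Longrightarrow> graded_map n as bs g \<Longrightarrow> graded_map n as bs (\<lambda>v. f v + g v)"
  by (intro graded_map_intro linear_map_add homog_vec_closed) (auto dest: graded_mapD)

lemma linear_map_neg: "linear_map n r s f \<Longrightarrow> linear_map n r s (\<lambda>v. - f v)"
  by (auto simp: linear_map_def Pi_iff scale_distrib)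

lemma graded_map_uminus:
  "graded_map n as bs f \<Longrightarrow> graded_map n as bs (\<lambda>v. - f v)"
  by (intro graded_map_intro homog_vec_closed linear_map_neg) (auto dest: graded_mapD)

definition vec_component :: "int list \<Rightarrow> int \<Rightarrow> (nat \<Rightarrow> 'k::field mpoly) \<Rightarrow> nat \<Rightarrow> 'k mpoly" where
  "vec_component as e v = (\<lambda>j. if j < length as then homogeneous_component (e - as ! j) (v j) else 0)"

lemma vec_component_in:
  "v \<in> free_vec n (length as) \<Longrightarrow> vec_component as e v \<in> homog_vec n as e"
  by (auto simp: vec_component_def homog_vec_def free_vec_def intro: homogeneous_component_in)

lemma vec_component_ident: "v \<in> homog_vec n as e \<Longrightarrow> vec_component as e v = v"
  by (auto simp: vec_component_def homog_vec_def homogeneous_component_ident fun_eq_iff)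

lemma graded_map_component:
  assumes f: "graded_map n as bs f" and v: "v \<in> free_vec n (length as)"
  shows "f (vec_component as e v) = vec_component bs e (f v)"
proof
  fix i
  note lin = graded_mapD(1)[OF f]
  have v': "vec_component as e v \<in> free_vec n (length as)"
    using vec_component_in[OF v] homog_vec_subset by blast
  show "f (vec_component as e v) i = vec_component bs e (f v) i"
  proof (cases "i < length bs")
    case True
    have entry: "f (unit_vec j) i \<in> homogeneous_part n (as ! j - bs ! i)" if "j < length as" for j
      using graded_mapD(2)[OF f unit_vec_in_homog_vec[OF that]] True by (simp add: homog_vec_def)
    have "vec_component bs e (f v) i = (\<Sum>j<length as. homogeneous_component (e - bs ! i) (v j * f (unit_vec j) i))"
      using True linear_map_expand[OF lin v]
      by (simp add: vec_component_def sum_fun_apply homogeneous_component_sum)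
    also have "\<dots> = (\<Sum>j<length as. homogeneous_component (e - as ! j) (v j) * f (unit_vec j) i)"
    proof (rule sum.cong[OF refl])
      fix j assume "j \<in> {..<length as}"
      then show "homogeneous_component (e - bs ! i) (v j * f (unit_vec j) i) =
          homogeneous_component (e - as ! j) (v j) * f (unit_vec j) i"
        using homogeneous_component_mult[OF entry[of j] free_vec_nth[OF v, of j], of "e - as ! j"] by simp
    qed
    also have "\<dots> = f (vec_component as e v) i"
      using linear_map_expand[OF lin v'] by (simp add: sum_fun_apply vec_component_def)
    finally show ?thesis by simp
  next
    case False
    then show ?thesis
      using linear_mapD(1)[OF lin v'] by (simp add: vec_component_def free_vec_def)
  qed
qed

text \<open>A graded map commutes with taking components of vectors, so any preimage of
  \<open>g (unit_vec j)\<close> may be replaced by its component of degree \<open>as ! j\<close>;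
  the lift is then homogeneous of degree 0.\<close>

lemma graded_map_lift:
  assumes \<delta>: "graded_map n bs cs \<delta>" and g: "graded_map n as cs g"
    and im: "\<And>v. v \<in> free_vec n (length as) \<Longrightarrow> g v \<in> \<delta> ` free_vec n (length bs)"
  obtains \<phi> where "graded_map n as bs \<phi>" "\<And>v. v \<in> free_vec n (length as) \<Longrightarrow> \<delta> (\<phi> v) = g v"
proof -
  note l\<delta> = graded_mapD(1)[OF \<delta>] and lg = graded_mapD(1)[OF g]
  define R where "R = {(v, w). v \<in> free_vec n (length as) \<and> w \<in> free_vec n (length bs) \<and> \<delta> w = g v}"
  obtain \<phi> where "linear_map n (length as) (length bs) \<phi>" "\<And>v. v \<in> free_vec n (length as) \<Longrightarrow> (v, \<phi> v) \<in> R"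
    "\<And>j. j < length as \<Longrightarrow> \<phi> (unit_vec j) \<in> homog_vec n bs (as ! j)"
  proof (rule linear_map_lift[of R n "length as" "\<lambda>j. homog_vec n bs (as ! j)" "length bs"])
    fix j assume j: "j < length as"
    then obtain w where w: "w \<in> free_vec n (length bs)" "g (unit_vec j) = \<delta> w"
      using im[of "unit_vec j"] by auto
    have "\<delta> (vec_component bs (as ! j) w) = g (unit_vec j)"
      using graded_map_component[OF \<delta> w(1)] w(2)
        vec_component_ident[OF graded_mapD(2)[OF g unit_vec_in_homog_vec[OF j]]] by simp
    then show "\<exists>w\<in>homog_vec n bs (as ! j). (unit_vec j, w) \<in> R"
      using vec_component_in[OF w(1)] homog_vec_subset j by (fastforce simp: R_def)
  qed (auto simp: R_def linear_mapD[OF l\<delta>] linear_mapD[OF lg] linear_map_0[OF l\<delta>] linear_map_0[OF lg]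
         intro: subsetD[OF homog_vec_subset])
  then show ?thesis by (intro that graded_mapI) (auto simp: R_def)
qed

text \<open>The matrix entry from basis vector \<open>i\<close> to \<open>j\<close> is homogeneous
  of degree \<open>as ! i - bs ! j > 0\<close>, so it has no constant term. This is the minimality
  criterion for the comparison map of a cone.\<close>

lemma graded_map_irrelevant:
  assumes f: "graded_map n as bs f" and deg: "\<And>i j. i < length as \<Longrightarrow> j < length bs \<Longrightarrow> bs ! j < as ! i"
    and v: "v \<in> free_vec n (length as)" and j: "j < length bs"
  shows "f v j \<in> irrelevant_ideal n"
proof -
  have "f (unit_vec i) j \<in> irrelevant_ideal n" if i: "i < length as" for i
  proof -
    have "f (unit_vec i) j \<in> homogeneous_part n (as ! i - bs ! j)"
      using graded_mapD(2)[OF f unit_vec_in_homog_vec[OF i]] j by (simp add: homog_vec_def)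
    then show ?thesis
      using deg[OF i j] by (auto simp: homogeneous_part_def irrelevant_ideal_eq supported_on_def)
  qed
  then have "(\<Sum>i<length as. f (unit_vec i) j * v i) \<in> irrelevant_ideal n"
    by (intro irrelevant_ideal_closed free_vec_nth[OF v]) simp
  then show ?thesis
    using linear_map_expand[OF graded_mapD(1)[OF f] v] by (simp add: sum_fun_apply mult.commute)
qed

section \<open>Direct sums of graded free modules\<close>

definition left_part :: "nat \<Rightarrow> (nat \<Rightarrow> 'a::zero) \<Rightarrow> nat \<Rightarrow> 'a" where
  "left_part r v = (\<lambda>j. if j < r then v j else 0)"

definition right_part :: "nat \<Rightarrow> (nat \<Rightarrow> 'a) \<Rightarrow> nat \<Rightarrow> 'a" where
  "right_part r v = (\<lambda>j. v (j + r))"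

definition join :: "nat \<Rightarrow> (nat \<Rightarrow> 'a) \<Rightarrow> (nat \<Rightarrow> 'a) \<Rightarrow> nat \<Rightarrow> 'a" where
  "join r x y = (\<lambda>j. if j < r then x j else y (j - r))"

lemma join_left_right [simp]: "join r (left_part r v) (right_part r v) = v"
  by (auto simp: join_def left_part_def right_part_def fun_eq_iff)

lemma left_part_join: "x \<in> free_vec n r \<Longrightarrow> left_part r (join r x y) = x"
  by (auto simp: join_def left_part_def free_vec_def fun_eq_iff)

lemma right_part_join [simp]: "right_part r (join r x y) = y"
  by (auto simp: join_def right_part_def fun_eq_iff)

lemma join_eq_0_iff: "x \<in> free_vec n r \<Longrightarrow> join r x y = 0 \<longleftrightarrow> x = 0 \<and> y = 0"
  by (auto simp: join_def free_vec_def fun_eq_iff) (metis add_diff_cancel_right' linorder_not_le not_add_less2)+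

lemma graded_map_left_part: "graded_map n (as @ bs) as (left_part (length as))"
  by (auto simp: graded_map_def linear_map_def left_part_def free_vec_def homog_vec_def fun_eq_iff nth_append)

lemma graded_map_right_part: "graded_map n (as @ bs) bs (right_part (length as))"
  by (auto simp: graded_map_def linear_map_def right_part_def free_vec_def homog_vec_def fun_eq_iff nth_append)
     (metis add.commute add_diff_cancel_left' add_less_cancel_left not_add_less1)

lemma join_in_free_vec:
  "x \<in> free_vec n r \<Longrightarrow> y \<in> free_vec n s \<Longrightarrow> join r x y \<in> free_vec n (r + s)"
  by (auto simp: join_def free_vec_def)

lemma join_in_homog_vec:
  "x \<in> homog_vec n as e \<Longrightarrow> y \<in> homog_vec n bs e \<Longrightarrow> join (length as) x y \<in> homog_vec n (as @ bs) e"
  by (auto simp: join_def homog_vec_def nth_append)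

lemma join_linear:
  "join r (x + x') (y + y') = join r x y + join r x' y'"
  "join r (scale c z) (scale c z') = scale c (join r z z')"
  by (auto simp: join_def fun_eq_iff)

lemma graded_map_join:
  assumes f: "graded_map n cs as f" and g: "graded_map n cs bs g"
  shows "graded_map n cs (as @ bs) (\<lambda>v. join (length as) (f v) (g v))"
  using linear_mapD[OF graded_mapD(1)[OF f]] linear_mapD[OF graded_mapD(1)[OF g]]
    graded_mapD(2)[OF f] graded_mapD(2)[OF g]
  by (auto simp: graded_map_def linear_map_def join_in_free_vec join_in_homog_vec join_linear)

lemma homog_vec_shift: "homog_vec n (map (\<lambda>x. x + a) as) e = homog_vec n as (e - a)"
  by (auto simp: homog_vec_def algebra_simps)

text \<open>Twisting changes only the degrees of the basis vectors, so a shifted complex keeps its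
  differentials as functions.\<close>

lemma graded_map_shift:
  assumes "graded_map n as bs f"
  shows "graded_map n (map (\<lambda>x. x + a) as) (map (\<lambda>x. x + a) bs) f"
  using assms by (auto simp: graded_map_def homog_vec_shift)

text \<open>The augmentation onto \<open>R/I\<close> is encoded by the image of
  \<open>\<delta> 0\<close> being the ideal inside \<open>R\<close>; cones can thus be formed before
  any quotient module is constructed.\<close>

definition ideal_resolution ::
  "nat \<Rightarrow> (nat \<Rightarrow>\<^sub>0 nat) set \<Rightarrow> (nat \<Rightarrow> int list) \<Rightarrow>
   (nat \<Rightarrow> (nat \<Rightarrow> 'k::field mpoly) \<Rightarrow> (nat \<Rightarrow> 'k mpoly)) \<Rightarrow> bool" where
  "ideal_resolution n S as \<delta> \<longleftrightarrow> as 0 = [0] \<and>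
     (\<forall>p. graded_map n (as (Suc p)) (as p) (\<delta> p)) \<and>
     \<delta> 0 ` free_vec n (length (as 1)) = {v \<in> free_vec n 1. v 0 \<in> supported_on S} \<and>
     (\<forall>p. {v \<in> free_vec n (length (as (Suc p))). \<delta> p v = 0} =
        \<delta> (Suc p) ` free_vec n (length (as (Suc (Suc p))))) \<and>
     (\<forall>p. \<forall>v\<in>free_vec n (length (as (Suc p))). \<forall>j<length (as p). \<delta> p v j \<in> irrelevant_ideal n)"

text \<open>The bounds on the degrees guarantee that the comparison map of a mapping cone has no units
  among its entries.\<close>

definition degree_bounds :: "int \<Rightarrow> (nat \<Rightarrow> int list) \<Rightarrow> bool" where
  "degree_bounds D as \<longleftrightarrow> (\<forall>p. \<forall>a\<in>set (as (Suc p)). int (Suc p) \<le> a \<and> a \<le> D + int p)"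

text \<open>The free module \<open>R = R/0\<close>, from which both iterations of cones
  start.\<close>

lemma ideal_resolution_empty: "ideal_resolution n {} (\<lambda>p. if p = 0 then [0] else []) (\<lambda>_ _. 0)"
proof -
  have "{v \<in> free_vec n (Suc 0). v 0 \<in> supported_on {}} = {0 :: nat \<Rightarrow> 'a mpoly}"
    by (auto simp: free_vec_def supported_on_def fun_eq_iff) (metis Suc_leI gr0I)
  moreover have "free_vec n 0 = {0 :: nat \<Rightarrow> 'a mpoly}"
    by (auto simp: free_vec_def fun_eq_iff)
  ultimately show ?thesis
    by (auto simp: ideal_resolution_def graded_map_def linear_map_def homog_vec_closed(1) irrelevant_ideal_iff)
qed

lemma graded_map_scale_monomial:
  assumes "u \<in> exponents n"
  shows "graded_map n [int (exp_degree u)] [0] (scale (monomial u))"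
proof (rule graded_mapI)
  show "linear_map n (length [int (exp_degree u)]) (length [0]) (scale (monomial u))"
    using assms by (auto simp: linear_map_def scale_distrib ac_simps)
  show "scale (monomial u) (unit_vec j) \<in> homog_vec n [0] ([int (exp_degree u)] ! j)"
    if "j < length [int (exp_degree u)]" for j
    using that assms
    by (auto simp: homog_vec_def unit_vec_def homogeneous_part_eq exponents_of_degree_def)
qed

text \<open>The set of exponents on the right is that of the colon ideal by \<open>u\<close>, which
  is thereby seen to be monomial again.\<close>

lemma monomial_mult_in_iff:
  assumes "f \<in> supported_on (exponents n)"
  shows "monomial u * f \<in> supported_on S \<longleftrightarrow> f \<in> supported_on {w \<in> exponents n. u + w \<in> S}"
  using assms by (auto simp: supported_on_def keys_monomial_mult)

text \<open>For \<open>I\<close> the ideal of \<open>S\<close> and \<open>a = exp_degree u\<close>,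
  multiplication by \<open>u\<close> gives the exact sequence
  \<open>0 -> (R/(I : u))(-a) -> R/I -> R/(I + (u)) -> 0\<close>. The cone of a lift of this map to
  resolutions resolves the cokernel; the bound \<open>1\<close> on \<open>ks\<close> makes the cone
  minimal and lets \<open>cs\<close> inherit the bound \<open>a\<close>, so that cones can be
  iterated.\<close>

theorem mapping_cone:
  fixes S :: "(nat \<Rightarrow>\<^sub>0 nat) set" and \<delta> \<kappa> :: "nat \<Rightarrow> (nat \<Rightarrow> 'k::field mpoly) \<Rightarrow> nat \<Rightarrow> 'k mpoly"
  assumes S: "upset n S" and u: "u \<in> exponents n" "u \<noteq> 0"
    and F: "ideal_resolution n S as \<delta>" "degree_bounds (int (exp_degree u)) as"
    and K: "ideal_resolution n {w \<in> exponents n. u + w \<in> S} ks \<kappa>" "degree_bounds 1 ks"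
  defines "cs \<equiv> \<lambda>p. as p @ (if p = 0 then [] else map (\<lambda>x. x + int (exp_degree u)) (ks (p - 1)))"
  shows "(\<exists>d :: nat \<Rightarrow> (nat \<Rightarrow> 'k mpoly) \<Rightarrow> nat \<Rightarrow> 'k mpoly.
      ideal_resolution n (S \<union> up_closure n {u}) cs d) \<and> degree_bounds (int (exp_degree u)) cs"
proof -
  let ?a = "int (exp_degree u)"
  have a: "?a \<ge> 1" using u(2) by (metis exp_degree_eq_0 le0 less_one linorder_not_le nat_int_comparison(2) of_nat_1)
  define X where "X p = (free_vec n (length (as p)) :: (nat \<Rightarrow> 'k mpoly) set)" for p
  define Y where "Y p = (free_vec n (length (ks p)) :: (nat \<Rightarrow> 'k mpoly) set)" for p
  define ks' where "ks' p = map (\<lambda>x. x + ?a) (ks p)" for p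
  have len [simp]: "length (ks' p) = length (ks p)" for p by (simp add: ks'_def)
  have as0: "as 0 = [0]" and ks0: "ks 0 = [0]"
    using F K by (simp_all add: ideal_resolution_def)
  have \<delta>: "graded_map n (as (Suc p)) (as p) (\<delta> p)" and \<kappa>: "graded_map n (ks' (Suc p)) (ks' p) (\<kappa> p)" for p
    using F(1) K(1) unfolding ideal_resolution_def ks'_def by (simp_all add: graded_map_shift)
  have \<delta>0: "\<delta> 0 ` X 1 = {v \<in> X 0. v 0 \<in> supported_on S}"
    using F as0 by (simp add: ideal_resolution_def X_def)
  have \<delta>Suc: "\<delta> (Suc p) ` X (Suc (Suc p)) = {v \<in> X (Suc p). \<delta> p v = 0}" for p
    using F by (simp add: ideal_resolution_def X_def)
  have \<kappa>0: "\<kappa> 0 ` Y 1 = {v \<in> Y 0. v 0 \<in> supported_on {w \<in> exponents n. u + w \<in> S}}"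
    using K ks0 by (simp add: ideal_resolution_def Y_def)
  have \<kappa>Suc: "\<kappa> (Suc p) ` Y (Suc (Suc p)) = {v \<in> Y (Suc p). \<kappa> p v = 0}" for p
    using K by (simp add: ideal_resolution_def Y_def)
  have \<delta>min: "\<delta> p v j \<in> irrelevant_ideal n" if "v \<in> X (Suc p)" "j < length (as p)" for p v j
    using F that by (simp add: ideal_resolution_def X_def)
  have \<kappa>min: "\<kappa> p v j \<in> irrelevant_ideal n" if "v \<in> Y (Suc p)" "j < length (ks p)" for p v j
    using K that by (simp add: ideal_resolution_def Y_def)
  note l\<delta> = graded_mapD(1)[OF \<delta>, folded X_def] and l\<kappa> = graded_mapD(1)[OF \<kappa>, unfolded len]
  have \<delta>X: "\<delta> p v \<in> X p" if "v \<in> X (Suc p)" for p v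
    using linear_mapD(1)[OF l\<delta>] that by (simp add: X_def)
  have \<kappa>Y: "\<kappa> p v \<in> Y p" if "v \<in> Y (Suc p)" for p v
    using linear_mapD(1)[OF l\<kappa>] that by (simp add: Y_def)
  have XY_closed: "x + x' \<in> X p" "x - x' \<in> X p" if "x \<in> X p" "x' \<in> X p" for x x' p
    using that by (simp_all add: X_def)

  \<comment> \<open>Invariant for the dependent choice: \<open>f\<close> maps boundaries to
    boundaries, which is exactly what the lift to the next position requires. The last conjunct pins
    the comparison map at position 0 to multiplication by \<open>u\<close>.\<close>
  define P where "P p f \<longleftrightarrow> graded_map n (ks' p) (as p) f \<and> (\<forall>v\<in>Y (Suc p). f (\<kappa> p v) \<in> \<delta> p ` X (Suc p)) \<and>
      (p = 0 \<longrightarrow> f = scale (monomial u))" for p f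
  define Q where "Q p f g \<longleftrightarrow> (\<forall>v\<in>Y (Suc p). \<delta> p (g v) = f (\<kappa> p v))"
    for p and f g :: "(nat \<Rightarrow> 'k mpoly) \<Rightarrow> nat \<Rightarrow> 'k mpoly"
  have "\<exists>\<alpha>. \<forall>p. P p (\<alpha> p) \<and> Q p (\<alpha> p) (\<alpha> (Suc p))"
  proof (rule dependent_nat_choice)
    \<comment> \<open>The image of \<open>\<kappa> 0\<close> is the colon ideal, and
      \<open>u\<close> times the colon ideal lies in the ideal of \<open>S\<close>.\<close>
    have "scale (monomial u) (\<kappa> 0 v) \<in> \<delta> 0 ` X (Suc 0)" if v: "v \<in> Y (Suc 0)" for v
    proof -
      have "\<kappa> 0 v \<in> {v \<in> Y 0. v 0 \<in> supported_on {w \<in> exponents n. u + w \<in> S}}"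
        using \<kappa>0 v by auto
      then have "scale (monomial u) (\<kappa> 0 v) \<in> {v \<in> X 0. v 0 \<in> supported_on S}"
        using u(1) monomial_mult_in_iff[of "\<kappa> 0 v 0" n u S] by (auto simp: X_def Y_def as0 ks0 free_vec_nth)
      then show ?thesis using \<delta>0 by simp
    qed
    then show "\<exists>f. P 0 f"
      using graded_map_scale_monomial[OF u(1)] by (auto simp: P_def ks'_def ks0 as0)
  next
    fix f p assume f: "P p f"
    then have gf: "graded_map n (ks' p) (as p) f" by (simp add: P_def)
    obtain g where g: "graded_map n (ks' (Suc p)) (as (Suc p)) g" "\<And>v. v \<in> Y (Suc p) \<Longrightarrow> \<delta> p (g v) = f (\<kappa> p v)"
      using graded_map_lift[OF \<delta> graded_map_compose[OF \<kappa> gf]] f unfolding P_def X_def Y_def len by blast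
    have "g (\<kappa> (Suc p) v) \<in> \<delta> (Suc p) ` X (Suc (Suc p))" if v: "v \<in> Y (Suc (Suc p))" for v
    proof -
      have "\<kappa> (Suc p) v \<in> {v \<in> Y (Suc p). \<kappa> p v = 0}" using \<kappa>Suc v by auto
      then show ?thesis
        unfolding \<delta>Suc using g linear_map_0[OF graded_mapD(1)[OF gf]] linear_mapD(1)[OF graded_mapD(1)[OF g(1)]]
        by (auto simp: X_def Y_def)
    qed
    then show "\<exists>g. P (Suc p) g \<and> Q p f g"
      using g by (auto simp: P_def Q_def)
  qed
  then obtain \<alpha> where \<alpha>: "\<And>p. P p (\<alpha> p)" "\<And>p. Q p (\<alpha> p) (\<alpha> (Suc p))" by blast
  have g\<alpha>: "graded_map n (ks' p) (as p) (\<alpha> p)" and \<alpha>0: "\<alpha> 0 = scale (monomial u)" for p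
    using \<alpha>(1) by (simp_all add: P_def)
  note l\<alpha> = graded_mapD(1)[OF g\<alpha>, unfolded len]
  have \<alpha>Y: "\<alpha> p v \<in> X p" if "v \<in> Y p" for p v
    using linear_mapD(1)[OF l\<alpha>] that by (simp add: X_def Y_def)
  have comm: "\<delta> p (\<alpha> (Suc p) v) = \<alpha> p (\<kappa> p v)" if "v \<in> Y (Suc p)" for p v
    using \<alpha>(2) that by (simp add: Q_def)

  have as_bound: "x < ?a + int p" if "x \<in> set (as p)" for x p
    using that F(2) a by (cases p) (fastforce simp: as0 degree_bounds_def)+
  \<comment> \<open>For the bound \<open>1\<close> the lower and the upper bound of
    \<open>degree_bounds\<close> coincide, so the shifted complex is linear; by
    \<open>as_bound\<close> all degrees of \<open>as p\<close> are strictly smaller.\<close>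
  have ks_bound: "x = ?a + int p" if "x \<in> set (ks' p)" for x p
    using that K(2) by (cases p) (force simp: ks0 ks'_def degree_bounds_def)+
  have \<alpha>min: "\<alpha> p v j \<in> irrelevant_ideal n" if "v \<in> Y p" "j < length (as p)" for p v j
  proof (rule graded_map_irrelevant[OF g\<alpha>])
    fix i j assume "i < length (ks' p)" "j < length (as p)"
    then show "as p ! j < ks' p ! i"
      using as_bound[of "as p ! j" p] ks_bound[of "ks' p ! i" p] nth_mem by force
  qed (use that in \<open>auto simp: Y_def\<close>)

  have cs0: "cs 0 = as 0" and csSuc: "cs (Suc p) = as (Suc p) @ ks' p" for p
    by (simp_all add: cs_def ks'_def)
  define Z where "Z p = (free_vec n (length (cs p)) :: (nat \<Rightarrow> 'k mpoly) set)" for p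
  define l where "l p = (left_part (length (as p)) :: (nat \<Rightarrow> 'k mpoly) \<Rightarrow> nat \<Rightarrow> 'k mpoly)" for p
  define r where "r p = (right_part (length (as p)) :: (nat \<Rightarrow> 'k mpoly) \<Rightarrow> nat \<Rightarrow> 'k mpoly)" for p
  define j where "j p = (join (length (as p)) :: (nat \<Rightarrow> 'k mpoly) \<Rightarrow> (nat \<Rightarrow> 'k mpoly) \<Rightarrow> nat \<Rightarrow> 'k mpoly)" for p
  have gl: "graded_map n (cs (Suc p)) (as (Suc p)) (l (Suc p))"
    and gr: "graded_map n (cs (Suc p)) (ks' p) (r (Suc p))" for p
    unfolding csSuc l_def r_def by (rule graded_map_left_part graded_map_right_part)+
  have lX: "l (Suc p) v \<in> X (Suc p)" and rY: "r (Suc p) v \<in> Y p" if "v \<in> Z (Suc p)" for p v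
    using linear_mapD(1)[OF graded_mapD(1)[OF gl]] linear_mapD(1)[OF graded_mapD(1)[OF gr]] that
    by (simp_all add: X_def Y_def Z_def)
  have jZ: "j (Suc p) x y \<in> Z (Suc p)" if "x \<in> X (Suc p)" "y \<in> Y p" for p x y
    using join_in_free_vec that by (force simp: X_def Y_def Z_def csSuc j_def)
  have lj: "l p (j p x y) = x" if "x \<in> X p" for p x y
    using left_part_join that by (simp add: X_def l_def j_def)
  have rj: "r p (j p x y) = y" for p x y
    by (simp add: r_def j_def)
  have jlr: "j p (l p v) (r p v) = v" for p v
    by (simp add: j_def l_def r_def)
  have j0: "j p x y = 0 \<longleftrightarrow> x = 0 \<and> y = 0" if "x \<in> X p" for p x y
    using join_eq_0_iff that by (simp add: X_def j_def)

  \<comment> \<open>The cone differential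
    \<open>(x, y) \<mapsto> (\<delta> x + \<alpha> y, - \<kappa> y)\<close>. Position
    \<open>Suc p\<close> carries \<open>ks' p\<close>, whence \<open>\<kappa> (p - 1)\<close>, and
    position 0 has no second summand.\<close>
  define d where "d p v = (let x = \<delta> p (l (Suc p) v) + \<alpha> p (r (Suc p) v) in
      if p = 0 then x else j p x (- \<kappa> (p - 1) (r (Suc p) v)))" for p v
  have d0: "d 0 v = \<delta> 0 (l 1 v) + \<alpha> 0 (r 1 v)" for v
    by (simp add: d_def)
  have dSuc: "d (Suc p) v = j (Suc p) (\<delta> (Suc p) (l (Suc (Suc p)) v) + \<alpha> (Suc p) (r (Suc (Suc p)) v))
      (- \<kappa> p (r (Suc (Suc p)) v))" for p v
    by (simp add: d_def Let_def)
  have gx: "graded_map n (cs (Suc p)) (as p) (\<lambda>v. \<delta> p (l (Suc p) v) + \<alpha> p (r (Suc p) v))" for p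
    by (intro graded_map_add graded_map_compose[OF gl \<delta>] graded_map_compose[OF gr g\<alpha>])
  have gd: "graded_map n (cs (Suc p)) (cs p) (d p)" for p
  proof (cases p)
    case 0
    then show ?thesis using gx[of 0] by (simp add: d0[abs_def] cs0)
  next
    case (Suc q)
    show ?thesis
      unfolding Suc dSuc[abs_def] csSuc[of q] j_def
      by (intro graded_map_join gx[of "Suc q"] graded_map_uminus graded_map_compose[OF gr \<kappa>])
  qed

  have "d 0 ` Z 1 = {v \<in> X 0. v 0 \<in> supported_on (S \<union> up_closure n {u})}"
  proof (intro equalityI subsetI)
    fix w assume "w \<in> d 0 ` Z 1"
    then obtain v where v: "v \<in> Z 1" "w = d 0 v" by blast
    have l: "l 1 v \<in> X 1" and r: "r 1 v \<in> Y 0" using lX[of v 0] rY[of v 0] v by auto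
    have "\<delta> 0 (l 1 v) \<in> {v \<in> X 0. v 0 \<in> supported_on S}"
      using \<delta>0 l by blast
    moreover have "monomial u * r 1 v 0 \<in> supported_on (up_closure n {u})"
      using r by (intro supported_on_mult[of _ "{u}" _ "exponents n"] free_vec_nth)
        (auto simp: Y_def up_closure_def)
    ultimately show "w \<in> {v \<in> X 0. v 0 \<in> supported_on (S \<union> up_closure n {u})}"
      using \<alpha>Y[OF r] XY_closed supported_on_mono[of S "S \<union> up_closure n {u}"]
        supported_on_mono[of "up_closure n {u}" "S \<union> up_closure n {u}"]
      by (auto simp: v d0 \<alpha>0)
  next
    fix w :: "nat \<Rightarrow> 'k mpoly" assume w: "w \<in> {v \<in> X 0. v 0 \<in> supported_on (S \<union> up_closure n {u})}"
    \<comment> \<open>The terms of \<open>w 0\<close> outside \<open>S\<close> are multiples of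
      \<open>u\<close>; their quotient by \<open>u\<close> is the entry wanted in the shifted
      summand, and the remaining terms lie in the image of \<open>\<delta> 0\<close>.\<close>
    define A where "A = keys (w 0) - S"
    define y where "y = (\<Sum>m\<in>A. single (m - u) (lookup (w 0) m))"
    have A: "m \<in> A \<Longrightarrow> \<exists>w\<in>exponents n. m = u + w" for m
      using w by (auto simp: A_def supported_on_def up_closure_def)
    have y: "y \<in> supported_on (exponents n)"
      unfolding y_def by (intro supported_on_sum) (use A in \<open>force simp: single_in_supported_on\<close>)
    have "monomial u * y = (\<Sum>m\<in>A. single m (lookup (w 0) m))"
    proof -
      have "u + (m - u) = m" if "m \<in> A" for m
        using A[OF that] by auto
      then show ?thesis
        by (auto simp: y_def sum_distrib_left monomial_def mult_single intro!: sum.cong)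
    qed
    moreover have "w 0 = (\<Sum>m\<in>keys (w 0) \<inter> S. single m (lookup (w 0) m)) + (\<Sum>m\<in>A. single m (lookup (w 0) m))"
      unfolding A_def by (rule trans[OF poly_mapping_eq_sum_single sum.Int_Diff]) simp
    ultimately have "w 0 - monomial u * y = (\<Sum>m\<in>keys (w 0) \<inter> S. single m (lookup (w 0) m))"
      by (metis add_diff_cancel_right')
    then have "w 0 - monomial u * y \<in> supported_on S"
      by (simp only:) (auto intro!: supported_on_sum simp: single_in_supported_on)
    moreover define t where "t = scale y (unit_vec 0 :: nat \<Rightarrow> 'k mpoly)"
    moreover have t: "t \<in> Y 0" using y by (auto simp: t_def Y_def ks0)
    ultimately have "w - \<alpha> 0 t \<in> {v \<in> X 0. v 0 \<in> supported_on S}"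
      using w XY_closed(2)[OF _ \<alpha>Y[OF t], of w] by (auto simp: \<alpha>0 unit_vec_def)
    then obtain x where x: "x \<in> X 1" "\<delta> 0 x = w - \<alpha> 0 t" using \<delta>0 by (metis (no_types, lifting) imageE)
    then have "d 0 (j 1 x t) = w" by (simp add: d0 lj rj)
    then show "w \<in> d 0 ` Z 1" using jZ[of x 0 t] x t by (metis One_nat_def imageI)
  qed
  moreover have "{v \<in> Z (Suc p). d p v = 0} = d (Suc p) ` Z (Suc (Suc p))" for p
  proof (intro equalityI subsetI)
    fix w assume "w \<in> d (Suc p) ` Z (Suc (Suc p))"
    then obtain v where v: "v \<in> Z (Suc (Suc p))" "w = d (Suc p) v" by blast
    define x y where "x = l (Suc (Suc p)) v" and "y = r (Suc (Suc p)) v"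
    have xy: "x \<in> X (Suc (Suc p))" "y \<in> Y (Suc p)" using lX rY v by (auto simp: x_def y_def)
    have lw: "l (Suc p) w = \<delta> (Suc p) x + \<alpha> (Suc p) y" and rw: "r (Suc p) w = - \<kappa> p y"
      using xy by (simp_all add: v dSuc lj rj XY_closed \<delta>X \<alpha>Y x_def[symmetric] y_def[symmetric])
    \<comment> \<open>Besides \<open>\<delta> \<delta> = 0\<close>, the sign of
      \<open>\<kappa>\<close> lets \<open>\<delta> \<alpha> y\<close> cancel against
      \<open>\<alpha> \<kappa> y\<close>.\<close>
    have "\<delta> (Suc p) x \<in> {v \<in> X (Suc p). \<delta> p v = 0}" using \<delta>Suc xy by blast
    then have "\<delta> p (l (Suc p) w) + \<alpha> p (r (Suc p) w) = 0"
      using xy linear_mapD(2)[OF l\<delta>, of "\<delta> (Suc p) x" p "\<alpha> (Suc p) y"] \<alpha>Y[OF xy(2)]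
        linear_map_uminus[OF l\<alpha>, of "\<kappa> p y" p] \<kappa>Y[OF xy(2)]
      by (simp add: lw rw comm) (simp add: X_def Y_def)
    moreover have "\<kappa> (p - 1) (r (Suc p) w) = 0" if "p \<noteq> 0"
    proof -
      obtain q where q: "p = Suc q" using \<open>p \<noteq> 0\<close> by (cases p) auto
      have "\<kappa> p y \<in> {v \<in> Y p. \<kappa> (p - 1) v = 0}" using \<kappa>Suc[of q] xy q by auto
      then show ?thesis using linear_map_uminus[OF l\<kappa>, of "\<kappa> p y" q] by (simp add: rw[unfolded q] q Y_def)
    qed
    ultimately have "d p w = 0"
      by (cases p) (simp_all add: d_def Let_def j_def join_def fun_eq_iff)
    moreover have "w \<in> Z (Suc p)"
      using linear_mapD(1)[OF graded_mapD(1)[OF gd]] v by (simp add: Z_def)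
    ultimately show "w \<in> {v \<in> Z (Suc p). d p v = 0}" by simp
  next
    fix v assume v: "v \<in> {v \<in> Z (Suc p). d p v = 0}"
    define x y where "x = l (Suc p) v" and "y = r (Suc p) v"
    have xy: "x \<in> X (Suc p)" "y \<in> Y p" using lX rY v by (auto simp: x_def y_def)
    have cycle: "\<delta> p x + \<alpha> p y = 0" and "p = 0 \<or> \<kappa> (p - 1) y = 0"
      using v xy by (cases p; simp add: d0 dSuc x_def y_def j0 XY_closed \<delta>X \<alpha>Y)+
    \<comment> \<open>At position 0 the cycle condition puts \<open>monomial u * y 0\<close> into
      the ideal of \<open>S\<close>, that is, \<open>y 0\<close> into the colon ideal; at later
      positions exactness of the resolution of the colon ideal applies.\<close>
    have "y \<in> \<kappa> p ` Y (Suc p)"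
    proof (cases p)
      case 0
      have "monomial u * y 0 = - \<delta> 0 x 0"
        using fun_cong[OF cycle, of 0] by (simp add: 0 \<alpha>0 add_eq_0_iff)
      moreover have "\<delta> 0 x \<in> {v \<in> X 0. v 0 \<in> supported_on S}" using \<delta>0 xy 0 by auto
      ultimately have "monomial u * y 0 \<in> supported_on S" by auto
      then show ?thesis
        using \<kappa>0 xy(2) monomial_mult_in_iff[of "y 0" n u S] by (auto simp: 0 Y_def free_vec_nth)
    next
      case (Suc q)
      then show ?thesis using \<kappa>Suc[of q] xy(2) \<open>p = 0 \<or> \<kappa> (p - 1) y = 0\<close> by auto
    qed
    then obtain z where z: "z \<in> Y (Suc p)" "y = \<kappa> p z" by blast
    \<comment> \<open>With \<open>y = \<kappa> z\<close> the corrected \<open>x + \<alpha> z\<close>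
      is a cycle, hence equal to some \<open>\<delta> t\<close>; then \<open>(t, - z)\<close> is
      sent to \<open>(\<delta> t - \<alpha> z, \<kappa> z) = (x, y)\<close>.\<close>
    have "\<delta> p (x + \<alpha> (Suc p) z) = 0"
      using cycle linear_mapD(2)[OF l\<delta>, of x p "\<alpha> (Suc p) z"] xy \<alpha>Y[OF z(1)] comm[OF z(1)] z(2)
      by (simp add: X_def)
    then have "x + \<alpha> (Suc p) z \<in> \<delta> (Suc p) ` X (Suc (Suc p))"
      unfolding \<delta>Suc using xy \<alpha>Y[OF z(1)] XY_closed by simp
    then obtain t where t: "t \<in> X (Suc (Suc p))" "\<delta> (Suc p) t = x + \<alpha> (Suc p) z" by (metis imageE)
    have mz: "- z \<in> Y (Suc p)" using z by (simp add: Y_def)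
    have "d (Suc p) (j (Suc (Suc p)) t (- z)) = j (Suc p) x y"
      using linear_map_uminus[OF l\<alpha>, of z "Suc p"] linear_map_uminus[OF l\<kappa>, of z p] z t
      by (simp add: dSuc lj rj Y_def)
    also have "\<dots> = v" by (simp add: x_def y_def jlr)
    finally show "v \<in> d (Suc p) ` Z (Suc (Suc p))" using jZ[OF t(1) mz] by (metis imageI)
  qed
  moreover have "d p v i \<in> irrelevant_ideal n" if v: "v \<in> Z (Suc p)" and i: "i < length (cs p)" for p v i
  proof -
    have x: "(\<delta> p (l (Suc p) v) + \<alpha> p (r (Suc p) v)) i \<in> irrelevant_ideal n" if "i < length (as p)"
      using that \<delta>min[OF lX[OF v]] \<alpha>min[OF rY[OF v]]
      by (auto intro!: irrelevant_ideal_closed(1))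
    show ?thesis
    proof (cases "i < length (as p)")
      case True
      then show ?thesis using x by (cases p) (simp_all add: d_def j_def join_def Let_def)
    next
      case False
      then obtain q where q: "p = Suc q" using i by (cases p) (auto simp: cs0)
      have "(- \<kappa> q (r (Suc p) v)) (i - length (as p)) \<in> irrelevant_ideal n"
        using \<kappa>min[of "r (Suc p) v" q "i - length (as p)"] rY[OF v] False i q
        by (auto simp: csSuc irrelevant_ideal_eq)
      then show ?thesis using False q by (simp add: dSuc j_def join_def)
    qed
  qed
  ultimately have "ideal_resolution n (S \<union> up_closure n {u}) cs d"
    unfolding ideal_resolution_def using gd by (simp add: Z_def X_def cs0 as0)
  \<comment> \<open>The new basis vectors at position \<open>Suc p\<close> have degree
    \<open>?a + int p\<close>, which attains the upper bound; the lower one follows from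
    \<open>?a \<ge> 1\<close>.\<close>
  moreover have "degree_bounds ?a cs"
    unfolding degree_bounds_def
  proof (intro allI ballI)
    fix p x assume "x \<in> set (cs (Suc p))"
    then show "int (Suc p) \<le> x \<and> x \<le> ?a + int p"
      using F(2) ks_bound[of x p] a by (auto simp: csSuc degree_bounds_def)
  qed
  ultimately show ?thesis by blast
qed

section \<open>Cyclic modules\<close>

lemma coset_eq_iff:
  "supported_on S +>\<^bsub>poly_ring n\<^esub> f = supported_on S +>\<^bsub>poly_ring n\<^esub> g \<longleftrightarrow> f - g \<in> supported_on S"
proof
  have coset: "supported_on S +>\<^bsub>poly_ring n\<^esub> f = (\<lambda>s. s + f) ` supported_on S" for f :: "'a mpoly"
    by (auto simp: a_r_coset_def')
  show "supported_on S +>\<^bsub>poly_ring n\<^esub> f = supported_on S +>\<^bsub>poly_ring n\<^esub> g"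
    if "f - g \<in> supported_on S"
  proof -
    have "x + f \<in> (\<lambda>s. s + g) ` supported_on S" "x + g \<in> (\<lambda>s. s + f) ` supported_on S"
      if "x \<in> supported_on S" for x
      using supported_on_add[OF that \<open>f - g \<in> _\<close>] supported_on_diff[OF that \<open>f - g \<in> _\<close>]
      by (auto intro: image_eqI[of _ _ "x + (f - g)"] image_eqI[of _ _ "x - (f - g)"] simp del: add_diff_eq)
    then show ?thesis unfolding coset by blast
  qed
  show "f - g \<in> supported_on S"
    if "supported_on S +>\<^bsub>poly_ring n\<^esub> f = supported_on S +>\<^bsub>poly_ring n\<^esub> g"
  proof -
    have "0 + f \<in> (\<lambda>s. s + g) ` supported_on S"
      using that unfolding coset by blast
    then show ?thesis by auto
  qed
qed

context
  fixes n :: nat and S :: "(nat \<Rightarrow>\<^sub>0 nat) set" and Q :: "('k::field mpoly, 'k mpoly set) gmodule"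
    and h :: "'k mpoly \<Rightarrow> 'k mpoly set"
  assumes S: "upset n S"
  defines "Q \<equiv> quotient_module n (supported_on S)"
    and "h \<equiv> \<lambda>f. supported_on S +>\<^bsub>poly_ring n\<^esub> f"
begin

lemma quotient_module_simps:
  "carrier Q = carrier (poly_ring n Quot supported_on S)"
  "add Q = add (poly_ring n Quot supported_on S)"
  "zero Q = zero (poly_ring n Quot supported_on S)"
  "f \<odot>\<^bsub>Q\<^esub> X = h f \<otimes>\<^bsub>poly_ring n Quot supported_on S\<^esub> X"
  "component Q e = h ` homogeneous_part n e"
  by (simp_all add: Q_def quotient_module_def Let_def h_def)

lemma quotient_carrier: "carrier Q = h ` supported_on (exponents n)"
  by (auto simp: quotient_module_simps FactRing_def A_RCOSETS_def RCOSETS_def h_def a_r_coset_def)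

lemma quotient_hom: "h \<in> ring_hom (poly_ring n) (poly_ring n Quot supported_on S)"
  using ideal.rcos_ring_hom[OF ideal_supported_on[OF S]] by (simp add: h_def[abs_def])

lemma quotient_add:
  "f \<in> supported_on (exponents n) \<Longrightarrow> g \<in> supported_on (exponents n) \<Longrightarrow> h f \<oplus>\<^bsub>Q\<^esub> h g = h (f + g)"
  using ring_hom_add[OF quotient_hom, of f g] by (simp add: quotient_module_simps)

lemma quotient_smult:
  "f \<in> supported_on (exponents n) \<Longrightarrow> g \<in> supported_on (exponents n) \<Longrightarrow> f \<odot>\<^bsub>Q\<^esub> h g = h (f * g)"
  using ring_hom_mult[OF quotient_hom, of f g] by (simp add: quotient_module_simps)

lemma quotient_eq_iff: "h f = h g \<longleftrightarrow> f - g \<in> supported_on S"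
  by (simp add: h_def coset_eq_iff)

lemma quotient_zero: "\<zero>\<^bsub>Q\<^esub> = h 0"
  by (auto simp: quotient_module_simps FactRing_def h_def a_r_coset_def')

lemma quotient_module: "Module.module (poly_ring n) Q"
proof (rule moduleI)
  show "cring (poly_ring n)" by (rule cring_poly_ring)
  show "abelian_group Q"
    by (rule abelian_groupI)
       (auto simp: quotient_carrier quotient_add quotient_zero supported_on_add supported_on_uminus add_ac
         intro!: bexI[of _ "- f" for f])
qed (auto simp: quotient_carrier quotient_add quotient_smult supported_on_add poly_ring_mult_closed
        distrib_left distrib_right mult.assoc)

lemma quotient_finsum:
  assumes "finite A" "\<And>e. e \<in> A \<Longrightarrow> g e \<in> supported_on (exponents n)"
  shows "finsum Q (\<lambda>e. h (g e)) A = h (sum g A)"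
proof -
  interpret Module.module "poly_ring n" Q by (rule quotient_module)
  show ?thesis
    using assms
    by (induction A rule: finite_induct)
       (auto simp: quotient_zero quotient_carrier quotient_add supported_on_sum)
qed

lemma quotient_component_subgroup: "additive_subgroup (component Q e) Q"
proof -
  interpret Module.module "poly_ring n" Q by (rule quotient_module)
  have sub: "homogeneous_part n e \<subseteq> supported_on (exponents n)"
    by (auto intro: homogeneous_part_carrier)
  have neg: "\<ominus>\<^bsub>Q\<^esub> h f = h (- f)" if "f \<in> supported_on (exponents n)" for f
    using that by (intro M.minus_equality)
      (auto simp: quotient_carrier quotient_add quotient_zero supported_on_uminus)
  show ?thesis
    unfolding quotient_module_simps(5)
  proof (intro additive_subgroupI M.add.subgroupI)
    show "h ` homogeneous_part n e \<subseteq> carrier Q"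
      using sub by (auto simp: quotient_carrier)
    show "h ` homogeneous_part n e \<noteq> {}"
      using supported_on_0 by (auto simp: homogeneous_part_eq)
    show "\<ominus>\<^bsub>Q\<^esub> a \<in> h ` homogeneous_part n e" if "a \<in> h ` homogeneous_part n e" for a
      using that sub by (auto simp: neg homogeneous_part_eq intro!: imageI supported_on_uminus)
    show "a \<oplus>\<^bsub>Q\<^esub> b \<in> h ` homogeneous_part n e"
      if ab: "a \<in> h ` homogeneous_part n e" "b \<in> h ` homogeneous_part n e" for a b
    proof -
      obtain f g where "a = h f" "b = h g" "f \<in> homogeneous_part n e" "g \<in> homogeneous_part n e"
        using ab by blast
      then show ?thesis
        using sub quotient_add[of f g] by (auto simp: homogeneous_part_eq intro!: imageI supported_on_add)
    qed
  qed
qed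

text \<open>Uniqueness holds because the ideal is spanned by monomials: along with an element it
  contains all of its homogeneous components.\<close>

lemma quotient_decomposition:
  assumes f: "f \<in> supported_on (exponents n)"
  shows "(\<forall>e. u e \<in> component Q e) \<and> finite {e. u e \<noteq> \<zero>\<^bsub>Q\<^esub>} \<and> h f = finsum Q u {e. u e \<noteq> \<zero>\<^bsub>Q\<^esub>} \<longleftrightarrow>
    u = (\<lambda>e. h (homogeneous_component e f))"
proof -
  let ?A = "{e. u e \<noteq> \<zero>\<^bsub>Q\<^esub>}"
  have carrier: "homogeneous_component e f \<in> supported_on (exponents n)" for e
    using f by (rule supported_on_homogeneous_component)
  show ?thesis
  proof
    assume u: "u = (\<lambda>e. h (homogeneous_component e f))"
    have "?A \<subseteq> (\<lambda>m. int (exp_degree m)) ` keys f"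
    proof
      fix e assume "e \<in> ?A"
      then have "homogeneous_component e f \<noteq> 0" by (auto simp: u quotient_zero)
      then show "e \<in> (\<lambda>m. int (exp_degree m)) ` keys f"
        by (auto simp: keys_homogeneous_component simp flip: keys_eq_empty)
    qed
    then have fin: "finite ?A" by (rule finite_subset) simp
    have "keys (f - (\<Sum>e\<in>?A. homogeneous_component e f)) \<subseteq> S"
    proof
      fix m assume m: "m \<in> keys (f - (\<Sum>e\<in>?A. homogeneous_component e f))"
      have "lookup (\<Sum>e\<in>?A. homogeneous_component e f) m = (if int (exp_degree m) \<in> ?A then lookup f m else 0)"
        using fin by (simp add: lookup_sum lookup_homogeneous_component)
      then have m': "int (exp_degree m) \<notin> ?A" "m \<in> keys f"
        using m by (auto simp: in_keys_iff lookup_minus split: if_splits)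
      then have "homogeneous_component (int (exp_degree m)) f \<in> supported_on S"
        by (simp add: u quotient_zero quotient_eq_iff)
      then show "m \<in> S" using m'(2) by (auto simp: supported_on_def keys_homogeneous_component)
    qed
    then have "h f = h (\<Sum>e\<in>?A. homogeneous_component e f)"
      by (simp add: quotient_eq_iff supported_on_def)
    also have "\<dots> = finsum Q (\<lambda>e. h (homogeneous_component e f)) ?A"
      using quotient_finsum[OF fin] carrier by simp
    finally show "(\<forall>e. u e \<in> component Q e) \<and> finite ?A \<and> h f = finsum Q u ?A"
      using fin homogeneous_component_in[OF f] by (auto simp: u quotient_module_simps(5))
  next
    assume *: "(\<forall>e. u e \<in> component Q e) \<and> finite ?A \<and> h f = finsum Q u ?A"
    \<comment> \<open>Choosing the representative \<open>0\<close> for every vanishing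
      \<open>u e\<close> makes the finite sum of representatives have component \<open>g e\<close>
      in every degree \<open>e\<close>, also outside \<open>?A\<close>.\<close>
    have "\<exists>g. g \<in> homogeneous_part n e \<and> u e = h g \<and> (u e = \<zero>\<^bsub>Q\<^esub> \<longrightarrow> g = 0)" for e
    proof (cases "u e = \<zero>\<^bsub>Q\<^esub>")
      case True
      then show ?thesis by (intro exI[of _ 0]) (auto simp: quotient_zero homogeneous_part_eq)
    next
      case False
      then show ?thesis using * by (auto simp: quotient_module_simps(5) image_iff)
    qed
    then obtain g where g: "\<And>e. g e \<in> homogeneous_part n e" "\<And>e. u e = h (g e)" "\<And>e. u e = \<zero>\<^bsub>Q\<^esub> \<Longrightarrow> g e = 0"
      by metis
    have "h f = finsum Q (\<lambda>e. h (g e)) ?A"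
      using * g(2) by presburger
    also have "\<dots> = h (sum g ?A)"
      using * homogeneous_part_carrier[OF g(1)] by (intro quotient_finsum) auto
    finally have "f - sum g ?A \<in> supported_on S"
      by (simp add: quotient_eq_iff)
    then have "homogeneous_component e (f - sum g ?A) \<in> supported_on S" for e
      by (rule supported_on_homogeneous_component)
    moreover have "homogeneous_component e (sum g ?A) = g e" for e
      using * g(3)[of e] by (auto simp: homogeneous_component_sum homogeneous_component_ident[OF g(1)])
    ultimately show "u = (\<lambda>e. h (homogeneous_component e f))"
      by (intro ext) (metis g(2) homogeneous_component_diff quotient_eq_iff)
  qed
qed

lemma graded_module_quotient: "graded_module n Q"
  unfolding graded_module_def
proof (intro conjI allI ballI quotient_module quotient_component_subgroup)
  fix c e and f :: "'k mpoly" and x assume "f \<in> homogeneous_part n c" "x \<in> component Q e"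
  then show "f \<odot>\<^bsub>Q\<^esub> x \<in> component Q (c + e)"
    unfolding quotient_module_simps(5)
    by (auto simp: quotient_smult homogeneous_part_carrier homogeneous_part_mult)
next
  fix x assume "x \<in> carrier Q"
  then obtain f where "x = h f" "f \<in> supported_on (exponents n)"
    by (auto simp: quotient_carrier)
  then show "\<exists>!u. (\<forall>e. u e \<in> component Q e) \<and> finite {e. u e \<noteq> \<zero>\<^bsub>Q\<^esub>} \<and>
      x = finsum Q u {e. u e \<noteq> \<zero>\<^bsub>Q\<^esub>}"
    by (simp add: quotient_decomposition)
qed

text \<open>Position 0 is \<open>R\<close> with its generator in degree 0, so a vector amounts to
  its entry at index 0, and the augmentation takes the residue class of this entry.\<close>

lemma minimal_resolution_quotient:
  assumes "ideal_resolution n S as \<delta>"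
  shows "minimal_graded_free_resolution n Q as \<delta> (\<lambda>v. h (v 0))"
proof -
  have as0: "as 0 = [0]" using assms by (simp add: ideal_resolution_def)
  have v0: "v 0 \<in> supported_on (exponents n)" if "v \<in> free_vec n (Suc 0)" for v :: "nat \<Rightarrow> 'k mpoly"
    using that by (rule free_vec_nth)
  have "graded_hom n (free_module n (as 0)) Q (\<lambda>v. h (v 0))"
    by (auto simp: graded_hom_def as0 quotient_carrier quotient_add quotient_smult v0
        quotient_module_simps(5) homog_vec_def)
  moreover have "(\<lambda>v. h (v 0)) ` carrier (free_module n (as 0)) = carrier Q"
  proof -
    have "h f \<in> (\<lambda>v. h (v 0)) ` free_vec n (Suc 0)" if "f \<in> supported_on (exponents n)" for f
      using that by (intro image_eqI[of _ _ "scale f (unit_vec 0)"]) (simp add: unit_vec_def, simp)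
    then show ?thesis by (auto simp: as0 quotient_carrier v0)
  qed
  moreover have "a_kernel (free_module n (as 0)) Q (\<lambda>v. h (v 0)) = \<delta> 0 ` carrier (free_module n (as 1))"
    using assms
    by (auto simp: ideal_resolution_def as0 a_kernel_def kernel_def quotient_zero quotient_eq_iff)
  ultimately show ?thesis
    using assms graded_module_quotient
    by (auto simp: minimal_graded_free_resolution_def graded_free_resolution_def Let_def
        graded_hom_free_module graded_map_def ideal_resolution_def a_kernel_def kernel_def)
qed

lemma betti_quotient:
  assumes "ideal_resolution n S as (\<delta> :: nat \<Rightarrow> (nat \<Rightarrow> 'k mpoly) \<Rightarrow> nat \<Rightarrow> 'k mpoly)"
  shows "betti n (quotient_module n (supported_on S) :: ('k mpoly, 'k mpoly set) gmodule) p = length (as p)"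
  using betti_eqI[OF minimal_resolution_quotient[OF assms]] by (simp add: Q_def)

end

section \<open>Linear quotients of strongly stable ideals\<close>

text \<open>The field occurs in neither \<open>S\<close>, \<open>b\<close> nor \<open>D\<close>,
  hence the type argument. \<open>b\<close> lists the ranks, and \<open>D\<close> is the degree
  bound that decides which generators may be added next.\<close>

definition resolvable :: "'k::field itself \<Rightarrow> nat \<Rightarrow> (nat \<Rightarrow>\<^sub>0 nat) set \<Rightarrow> (nat \<Rightarrow> nat) \<Rightarrow> nat \<Rightarrow> bool" where
  "resolvable k n S b D \<longleftrightarrow> (\<exists>as. \<exists>\<delta> :: nat \<Rightarrow> (nat \<Rightarrow> 'k mpoly) \<Rightarrow> nat \<Rightarrow> 'k mpoly.
     ideal_resolution n S as \<delta> \<and> degree_bounds (int D) as \<and> (\<forall>p. length (as p) = b p))"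

lemma resolvable_mono: "resolvable k n S b D \<Longrightarrow> D \<le> E \<Longrightarrow> resolvable k n S b E"
  unfolding resolvable_def degree_bounds_def by fastforce

lemma resolvable_empty: "resolvable TYPE('k::field) n {} (\<lambda>p. if p = 0 then 1 else 0) D"
  unfolding resolvable_def
  by (intro exI[of _ "\<lambda>p. if p = 0 then [0] else []"] exI[of _ "\<lambda>_ _. 0"] conjI ideal_resolution_empty)
     (auto simp: degree_bounds_def)

lemma resolvable_cone:
  assumes "resolvable TYPE('k::field) n S b (exp_degree u)"
    and "resolvable TYPE('k) n {w \<in> exponents n. u + w \<in> S} c 1"
    and "upset n S" "u \<in> exponents n" "u \<noteq> 0"
  shows "resolvable TYPE('k) n (S \<union> up_closure n {u}) (\<lambda>p. b p + (if p = 0 then 0 else c (p - 1))) (exp_degree u)"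
proof -
  obtain as and \<delta> :: "nat \<Rightarrow> (nat \<Rightarrow> 'k mpoly) \<Rightarrow> nat \<Rightarrow> 'k mpoly"
    where F: "ideal_resolution n S as \<delta>" "degree_bounds (int (exp_degree u)) as" "\<And>p. length (as p) = b p"
    using assms(1) unfolding resolvable_def by blast
  obtain ks and \<kappa> :: "nat \<Rightarrow> (nat \<Rightarrow> 'k mpoly) \<Rightarrow> nat \<Rightarrow> 'k mpoly"
    where K: "ideal_resolution n {w \<in> exponents n. u + w \<in> S} ks \<kappa>" "degree_bounds 1 ks" "\<And>p. length (ks p) = c p"
    using assms(2) unfolding resolvable_def by auto
  show ?thesis
    using mapping_cone[OF assms(3-5) F(1,2) K(1,2)] unfolding resolvable_def
    by (auto simp: F(3) K(3) intro!: exI[of _ "\<lambda>p. as p @ _ p"])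
qed

lemma betti_resolvable:
  assumes "resolvable TYPE('k::field) n S b D" "upset n S"
  shows "betti n (quotient_module n (supported_on S :: 'k mpoly set)) p = b p"
  using assms betti_quotient unfolding resolvable_def by metis

text \<open>For \<open>t \<le> n\<close>, the monomials of the prime ideal
  \<open>(x_1, ..., x_t)\<close>; for \<open>t = 0\<close> there are none.\<close>

definition touches :: "nat \<Rightarrow> nat \<Rightarrow> (nat \<Rightarrow>\<^sub>0 nat) set" where
  "touches n t = {m \<in> exponents n. keys m \<inter> {1..t} \<noteq> {}}"

lemma keys_add_nat: "keys (a + b) = keys a \<union> keys b" for a b :: "nat \<Rightarrow>\<^sub>0 nat"
  by (auto simp: in_keys_iff lookup_add)

lemma exp_degree_pos [simp]: "0 < exp_degree m \<longleftrightarrow> m \<noteq> 0"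
  by (metis exp_degree_eq_0 gr0I less_irrefl)

lemma upset_touches: "upset n (touches n t)"
  by (auto simp: upset_def touches_def keys_add_nat)

lemma add_diff_single: "i \<in> keys m \<Longrightarrow> single i 1 + (m - single i 1) = m" for m :: "nat \<Rightarrow>\<^sub>0 nat"
  by (intro poly_mapping_eqI) (auto simp: lookup_add lookup_minus lookup_single in_keys_iff when_def)

lemma touches_Suc:
  assumes "Suc t \<le> n"
  shows "touches n (Suc t) = touches n t \<union> up_closure n {single (Suc t) 1}"
proof (intro equalityI subsetI)
  fix m assume m: "m \<in> touches n (Suc t)"
  show "m \<in> touches n t \<union> up_closure n {single (Suc t) 1}"
  proof (cases "Suc t \<in> keys m")
    case True
    have "m - single (Suc t) 1 \<in> exponents n"
      using m by (auto simp: touches_def)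
    then have "m \<in> up_closure n {single (Suc t) 1}"
      unfolding up_closure_def using add_diff_single[OF True, symmetric] by blast
    then show ?thesis by blast
  next
    case False
    then show ?thesis using m by (auto simp: touches_def le_Suc_eq)
  qed
next
  fix m assume "m \<in> touches n t \<union> up_closure n {single (Suc t) 1}"
  then show "m \<in> touches n (Suc t)"
    using assms by (auto simp: touches_def up_closure_def keys_add_nat intro!: exponents_add exponents_single)
qed

text \<open>The Koszul complex on \<open>x_1, ..., x_t\<close>. Since
  \<open>(x_1, ..., x_t) : x_{t+1}\<close> is \<open>(x_1, ..., x_t)\<close> itself, both parts of
  the cone have the same ranks and Pascal's rule adds them; generators of degree 1 keep the bound at
  1.\<close>

lemma resolvable_touches:
  "t \<le> n \<Longrightarrow> resolvable TYPE('k::field) n (touches n t) (\<lambda>p. t choose p) 1"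
proof (induction t)
  case 0
  have "touches n 0 = {}" "(\<lambda>p. 0 choose p) = (\<lambda>p. if p = 0 then 1 else 0)"
    by (auto simp: touches_def fun_eq_iff)
  then show ?case using resolvable_empty by metis
next
  case (Suc t)
  let ?u = "single (Suc t) (1::nat)"
  have colon: "{w \<in> exponents n. ?u + w \<in> touches n t} = touches n t"
    using Suc.prems exponents_single[of "Suc t" n 1] by (auto simp: touches_def keys_add_nat)
  have "(\<lambda>p. (t choose p) + (if p = 0 then 0 else t choose (p - 1))) = (\<lambda>p. Suc t choose p)"
  proof
    fix p
    show "(t choose p) + (if p = 0 then 0 else t choose (p - 1)) = Suc t choose p"
      by (cases p) auto
  qed
  moreover have "?u \<noteq> 0" by (metis exp_degree_0 exp_degree_single zero_neq_one)
  ultimately show ?case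
    using resolvable_cone[of n "touches n t" "\<lambda>p. t choose p" ?u "\<lambda>p. t choose p"] Suc colon
      upset_touches exponents_single[of "Suc t" n 1] by (simp add: touches_Suc)
qed

section \<open>Strongly stable sets and their minimal generators\<close>

definition strongly_stable_set :: "nat \<Rightarrow> (nat \<Rightarrow>\<^sub>0 nat) set \<Rightarrow> bool" where
  "strongly_stable_set n S \<longleftrightarrow> upset n S \<and>
     (\<forall>m\<in>S. \<forall>i\<in>keys m. \<forall>j. 1 \<le> j \<and> j < i \<longrightarrow> m - single i 1 + single j 1 \<in> S)"

definition minimal_elements :: "(nat \<Rightarrow>\<^sub>0 nat) set \<Rightarrow> (nat \<Rightarrow>\<^sub>0 nat) set" where
  "minimal_elements S = {m \<in> S. \<forall>g\<in>S. \<forall>w. m = g + w \<longrightarrow> w = 0}"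

definition max_var :: "(nat \<Rightarrow>\<^sub>0 nat) \<Rightarrow> nat" where
  "max_var m = Max (keys m)"

lemma minimal_elements_subset: "minimal_elements S \<subseteq> S"
  by (auto simp: minimal_elements_def)

lemma above_minimal_element:
  assumes "m \<in> S"
  shows "\<exists>g\<in>minimal_elements S. \<exists>w. m = g + w"
  using assms
proof (induction "exp_degree m" arbitrary: m rule: less_induct)
  case less
  show ?case
  proof (cases "m \<in> minimal_elements S")
    case True
    then show ?thesis by (intro bexI[of _ m] exI[of _ 0]) auto
  next
    case False
    then obtain g w where gw: "g \<in> S" "m = g + w" "w \<noteq> 0"
      using less.prems by (auto simp: minimal_elements_def)
    then have "exp_degree g < exp_degree m" by simp
    then obtain g' w' where "g' \<in> minimal_elements S" "g = g' + w'" using less.hyps gw by blast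
    then show ?thesis using gw by (auto simp: add.assoc)
  qed
qed

lemma exponents_add_iff: "a + b \<in> exponents n \<longleftrightarrow> a \<in> exponents n \<and> b \<in> exponents n"
  by (auto simp: exponents_def keys_add_nat)

lemma up_closure_minimal_elements:
  assumes "upset n S"
  shows "up_closure n (minimal_elements S) = S"
proof
  show "up_closure n (minimal_elements S) \<subseteq> S"
    by (rule up_closure_least[OF assms minimal_elements_subset])
  show "S \<subseteq> up_closure n (minimal_elements S)"
  proof
    fix m assume m: "m \<in> S"
    then obtain g w where gw: "g \<in> minimal_elements S" "m = g + w" using above_minimal_element by blast
    moreover have "w \<in> exponents n" using gw m upset_subset[OF assms] exponents_add_iff by blast
    ultimately show "m \<in> up_closure n (minimal_elements S)" by (auto simp: up_closure_def)
  qed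
qed

lemma lookup_shift:
  assumes "i \<in> keys m" "j \<noteq> i"
  shows "lookup (m - single i 1 + single j 1) k =
    (if k = i then lookup m k - 1 else if k = j then lookup m k + 1 else lookup m k)"
  using assms by (auto simp: lookup_add lookup_minus lookup_single when_def)

lemma exp_degree_shift:
  assumes "i \<in> keys m"
  shows "exp_degree (m - single i 1 + single j 1) = exp_degree m"
proof -
  have "exp_degree m = exp_degree (single i 1 + (m - single i 1))"
    by (simp only: add_diff_single[OF assms])
  then show ?thesis by simp
qed

lemma leq_imp_add: "(\<And>i. lookup g i \<le> lookup u i) \<Longrightarrow> u = g + (u - g)" for u g :: "nat \<Rightarrow>\<^sub>0 nat"
  by (intro poly_mapping_eqI) (simp add: lookup_add lookup_minus)

text \<open>The excess of \<open>g\<close> over \<open>u\<close> sits in variables behind those where \<open>g\<close> falls short of \<open>u\<close>, so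
  strong stability allows to move it there.\<close>

lemma strongly_stable_move:
  assumes S: "strongly_stable_set n S" and u: "u \<in> exponents n" "\<And>i. t < i \<Longrightarrow> lookup u i = 0"
    and "g \<in> S" "\<And>i. i < t \<Longrightarrow> lookup g i \<le> lookup u i" "exp_degree g \<le> exp_degree u"
  shows "\<exists>g'\<in>S. (\<exists>w. u = g' + w) \<and> exp_degree g' = exp_degree g"
  using assms(4-6)
\<comment> \<open>Truncated subtraction makes the measure the total excess of \<open>g\<close> over
  \<open>u\<close>; each exchange lowers it by one.\<close>
proof (induction "\<Sum>i=1..n. lookup g i - lookup u i" arbitrary: g rule: less_induct)
  case less
  have S_exp: "S \<subseteq> exponents n" using S by (simp add: strongly_stable_set_def upset_def)
  then have g: "g \<in> exponents n" using less.prems by blast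
  show ?case
  proof (cases "\<forall>i. lookup g i \<le> lookup u i")
    case True
    then show ?thesis using less.prems leq_imp_add[of g u] by blast
  next
    case False
    then obtain i where i: "lookup u i < lookup g i" by (auto simp: not_le)
    have ik: "i \<in> keys g" using i by (auto simp: in_keys_iff)
    then have i1n: "i \<in> {1..n}" using g by (auto simp: exponents_def)
    have "i \<ge> t" using i less.prems(2)[of i] by (metis leI less_le_not_le)
    \<comment> \<open>As \<open>exp_degree g\<close> does not exceed \<open>exp_degree u\<close>,
      the excess at \<open>i\<close> forces a deficit at some \<open>j\<close>. Since
      \<open>u\<close> vanishes beyond \<open>t\<close> and \<open>g\<close> has no excess before
      \<open>t\<close>, this gives \<open>j \<le> t \<le> i\<close>, and \<open>x_i\<close> may be
      exchanged for \<open>x_j\<close>.\<close>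
    have "\<exists>j\<in>{1..n}. lookup g j < lookup u j"
    proof (rule ccontr)
      assume "\<not> ?thesis"
      then have "(\<Sum>j=1..n. lookup u j) < (\<Sum>j=1..n. lookup g j)"
        using i i1n by (intro sum_strict_mono_ex1) (auto simp: not_less)
      then show False
        using less.prems(3) g u(1) by (simp add: exp_degree_exponents)
    qed
    then obtain j where j: "j \<in> {1..n}" "lookup g j < lookup u j" by blast
    have "j \<le> t" using u(2)[of j] j by (metis not_le not_less0)
    then have ji: "j < i" using \<open>i \<ge> t\<close> i j by (metis le_neq_implies_less le_trans not_less_iff_gr_or_eq)
    define g' where "g' = g - single i 1 + single j 1"
    have look: "lookup g' k = (if k = i then lookup g k - 1 else if k = j then lookup g k + 1 else lookup g k)" for k
      unfolding g'_def using ik ji by (intro lookup_shift) auto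
    have "g' \<in> S"
      using S less.prems(1) ik ji j(1) unfolding g'_def strongly_stable_set_def by auto
    moreover have "(\<Sum>k=1..n. lookup g' k - lookup u k) < (\<Sum>k=1..n. lookup g k - lookup u k)"
      using i i1n j ji by (intro sum_strict_mono_ex1) (auto simp: look)
    moreover have "lookup g' k \<le> lookup u k" if "k < t" for k
      using less.prems(2)[OF that] j by (auto simp: look)
    moreover have deg: "exp_degree g' = exp_degree g"
      unfolding g'_def by (rule exp_degree_shift[OF ik])
    ultimately obtain g'' where "g'' \<in> S" "\<exists>w. u = g'' + w" "exp_degree g'' = exp_degree g'"
      using less.hyps[of g'] less.prems(3) by auto
    then show ?thesis using deg by auto
  qed
qed

text \<open>The order of \<^typ>\<open>nat \<Rightarrow>\<^sub>0 nat\<close> compares exponents lexicographically from the first variable on;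
  within a degree, the generators are added in decreasing order.\<close>

definition precedes :: "(nat \<Rightarrow>\<^sub>0 nat) \<Rightarrow> (nat \<Rightarrow>\<^sub>0 nat) \<Rightarrow> bool" where
  "precedes g u \<longleftrightarrow> exp_degree g < exp_degree u \<or> exp_degree g = exp_degree u \<and> u < g"

lemma less_poly_mapping_iff:
  "u < g \<longleftrightarrow> (\<exists>k. lookup u k < lookup g k \<and> (\<forall>i<k. lookup u i = lookup g i))" for u g :: "nat \<Rightarrow>\<^sub>0 nat"
  by (simp add: less_poly_mapping.rep_eq less_fun_def)

lemma max_var_props:
  assumes "m \<noteq> 0"
  shows "max_var m \<in> keys m" "\<And>i. max_var m < i \<Longrightarrow> lookup m i = 0"
proof -
  have ne: "keys m \<noteq> {}" using assms by simp
  show "max_var m \<in> keys m" unfolding max_var_def by (rule Max_in[OF finite_keys ne])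
  show "lookup m i = 0" if "max_var m < i" for i
    using that Max_ge[OF finite_keys, of i m] unfolding max_var_def
    by (metis leD not_in_keys_iff_lookup_eq_zero)
qed

text \<open>Let \<open>t = max_var u\<close>. If \<open>w\<close> avoids the variables before
  \<open>t\<close>, an earlier generator \<open>g\<close> dividing \<open>u w\<close> could be moved
  to a divisor of \<open>u\<close>; minimality of \<open>u\<close> then leaves only a
  \<open>g\<close> of the same degree that is lexicographically larger, which the exponents exclude.
  Conversely, each \<open>x_i\<close> with \<open>i < t\<close> is in the colon ideal because
  \<open>u x_i\<close> is a multiple of \<open>(x_i / x_t) u\<close>.\<close>

lemma colon_initial_segment:
  assumes S: "strongly_stable_set n S" and u: "u \<in> minimal_elements S" "u \<noteq> 0"
    and A: "A \<subseteq> minimal_elements S" "\<And>g. g \<in> A \<longleftrightarrow> g \<in> minimal_elements S \<and> precedes g u"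
  shows "{w \<in> exponents n. u + w \<in> up_closure n A} = touches n (max_var u - 1)"
proof (intro equalityI subsetI)
  let ?t = "max_var u"
  have up: "upset n S" using S by (simp add: strongly_stable_set_def)
  have uS: "u \<in> S" "u \<in> exponents n" using u upset_subset[OF up] by (auto simp: minimal_elements_def)
  note t = max_var_props[OF u(2)]
  fix w assume "w \<in> {w \<in> exponents n. u + w \<in> up_closure n A}"
  then obtain g x where w: "w \<in> exponents n" and g: "g \<in> A" and eq: "u + w = g + x"
    by (auto simp: up_closure_def)
  have gS: "g \<in> S" "g \<in> exponents n" and prec: "precedes g u"
    using g A upset_subset[OF up] by (auto simp: minimal_elements_def)
  show "w \<in> touches n (?t - 1)"
  proof (rule ccontr)
    assume "w \<notin> touches n (?t - 1)"
    then have "lookup w i = 0" if "i < ?t" for i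
      using w that by (cases "i = 0") (force simp: touches_def exponents_def in_keys_iff)+
    then have le: "lookup g i \<le> lookup u i" if "i < ?t" for i
      using arg_cong[OF eq, of "\<lambda>m. lookup m i"] that by (simp add: lookup_add)
    have "exp_degree g \<le> exp_degree u" using prec by (auto simp: precedes_def)
    then obtain g' v where g': "g' \<in> S" "u = g' + v" "exp_degree g' = exp_degree g"
      using strongly_stable_move[OF S uS(2) t(2) gS(1) le] by blast
    then have "v = 0" using u(1) by (auto simp: minimal_elements_def)
    then have deg: "exp_degree g = exp_degree u" using g' by simp
    then have "u < g" using prec by (simp add: precedes_def)
    then obtain k where k: "lookup u k < lookup g k" "\<And>i. i < k \<Longrightarrow> lookup u i = lookup g i"
      by (auto simp: less_poly_mapping_iff)
    \<comment> \<open>The first difference lies at or behind the last variable of \<open>u\<close>,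
      so \<open>u\<close> divides \<open>g\<close> properly, against the equality of
      degrees.\<close>
    then have "?t \<le> k" using le[of k] by (meson leD leI)
    then have "lookup u i \<le> lookup g i" for i
      using t(2)[of i] k(2)[of i] k(1) by (cases i k rule: linorder_cases) auto
    moreover have "k \<in> keys g" using k(1) by (auto simp: in_keys_iff)
    then have "k \<in> {1..n}" using gS(2) by (auto simp: exponents_def)
    ultimately have "(\<Sum>i=1..n. lookup u i) < (\<Sum>i=1..n. lookup g i)"
      using k(1) by (intro sum_strict_mono_ex1) auto
    then show False
      using deg by (simp only: exp_degree_exponents[OF uS(2)] exp_degree_exponents[OF gS(2)])
  qed
next
  let ?t = "max_var u"
  have up: "upset n S" using S by (simp add: strongly_stable_set_def)
  have uS: "u \<in> S" "u \<in> exponents n" using u upset_subset[OF up] by (auto simp: minimal_elements_def)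
  note t = max_var_props[OF u(2)]
  fix w assume "w \<in> touches n (?t - 1)"
  then obtain i where w: "w \<in> exponents n" and "i \<in> keys w" "1 \<le> i" "i \<le> ?t - 1"
    by (auto simp: touches_def)
  then have i: "i \<in> keys w" "1 \<le> i" "i < ?t" by simp_all
  define m where "m = u - single ?t 1 + single i 1"
  have m: "m \<in> S" unfolding m_def using S uS t(1) i by (auto simp: strongly_stable_set_def)
  have deg: "exp_degree m = exp_degree u" unfolding m_def by (rule exp_degree_shift[OF t(1)])
  obtain g x where g: "g \<in> minimal_elements S" "m = g + x" using above_minimal_element[OF m] by blast
  \<comment> \<open>A generator dividing \<open>m\<close> is either \<open>m\<close> itself, of the
    same degree as \<open>u\<close> and lexicographically larger, or it has smaller degree.\<close>
  have "precedes g u"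
  proof (cases "x = 0")
    case True
    have "lookup m k = (if k = ?t then lookup u k - 1 else if k = i then lookup u k + 1 else lookup u k)" for k
      unfolding m_def using t(1) i by (intro lookup_shift) auto
    then have "u < m" using i(3) by (auto simp: less_poly_mapping_iff intro!: exI[of _ i])
    then show ?thesis using True g deg by (simp add: precedes_def)
  next
    case False
    then have "0 < exp_degree x" by simp
    then have "exp_degree g < exp_degree u" using g(2) deg by (simp del: exp_degree_pos)
    then show ?thesis by (simp add: precedes_def)
  qed
  then have gA: "g \<in> A" using A g by blast
  have "u + w = (single ?t 1 + (u - single ?t 1)) + (single i 1 + (w - single i 1))"
    by (simp only: add_diff_single[OF t(1)] add_diff_single[OF i(1)])
  also have "\<dots> = m + (single ?t 1 + (w - single i 1))"
    unfolding m_def by (simp only: add_ac)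
  also have "\<dots> = g + (x + (single ?t 1 + (w - single i 1)))"
    by (simp add: g add_ac)
  finally have eq: "u + w = g + (x + (single ?t 1 + (w - single i 1)))" .
  moreover have "x + (single ?t 1 + (w - single i 1)) \<in> exponents n"
    using exponents_add[OF uS(2) w] unfolding eq exponents_add_iff by blast
  ultimately have "u + w \<in> up_closure n A"
    unfolding up_closure_def using gA by blast
  then show "w \<in> {w \<in> exponents n. u + w \<in> up_closure n A}" using w by simp
qed

text \<open>Induction over initial segments \<open>A\<close> of the order, removing the last
  generator. For initial segments the colon ideal is known, and the last generator has the largest
  degree, as the bound in the cone demands.\<close>

theorem resolvable_strongly_stable:
  assumes S: "strongly_stable_set n S" and 0: "0 \<notin> S" and fin: "finite (minimal_elements S)"
  shows "\<exists>D. resolvable TYPE('k::field) n S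
    (\<lambda>p. if p = 0 then 1 else \<Sum>m\<in>minimal_elements S. (max_var m - 1) choose (p - 1)) D"
proof -
  have up: "upset n S" using S by (simp add: strongly_stable_set_def)
  have segment: "resolvable TYPE('k) n (up_closure n A)
      (\<lambda>p. if p = 0 then 1 else \<Sum>m\<in>A. (max_var m - 1) choose (p - 1)) D"
    if "A \<subseteq> minimal_elements S" "\<And>g u. u \<in> A \<Longrightarrow> g \<in> minimal_elements S \<Longrightarrow> precedes g u \<Longrightarrow> g \<in> A"
      "\<And>u. u \<in> A \<Longrightarrow> exp_degree u \<le> D" for A D
    using that
  proof (induction "card A" arbitrary: A D)
    case 0
    then have "A = {}" using finite_subset[OF _ fin] by (metis card_eq_0_iff)
    then show ?case using resolvable_empty[where 'k = 'k, of n D] by (simp add: up_closure_def cong: if_cong)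
  next
    case (Suc c)
    have finA: "finite A" using Suc.hyps(2) by (metis card.infinite nat.distinct(1))
    have "A \<noteq> {}" using Suc.hyps(2) by auto
    define e where "e = Max (exp_degree ` A)"
    \<comment> \<open>The last generator of the segment: lexicographically smallest among those of
      maximal degree.\<close>
    define u where "u = Min {g \<in> A. exp_degree g = e}"
    have "e \<in> exp_degree ` A" unfolding e_def using finA \<open>A \<noteq> {}\<close> by (intro Max_in) auto
    then have "u \<in> {g \<in> A. exp_degree g = e}" unfolding u_def using finA by (intro Min_in) auto
    then have u: "u \<in> A" "exp_degree u = e" by auto
    have before: "precedes g u" if "g \<in> A" "g \<noteq> u" for g
    proof -
      have "exp_degree g \<le> e" unfolding e_def using finA that by simp
      moreover have "u \<le> g" if "exp_degree g = e"
        unfolding u_def using finA \<open>g \<in> A\<close> that by (intro Min_le) auto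
      ultimately show ?thesis using u that by (auto simp: precedes_def le_less)
    qed
    have u': "u \<in> minimal_elements S" "u \<in> exponents n" "u \<noteq> 0"
      using Suc.prems(1) u 0 upset_subset[OF up] by (auto simp: minimal_elements_def)
    define B where "B = A - {u}"
    have B: "g \<in> B \<longleftrightarrow> g \<in> minimal_elements S \<and> precedes g u" for g
      using Suc.prems(1,2) before u by (auto simp: B_def precedes_def)
    \<comment> \<open>The bound \<open>D\<close> is replaced by \<open>exp_degree u\<close>, which
      the cone with \<open>u\<close> requires; \<open>resolvable_mono\<close> returns to
      \<open>D\<close> afterwards.\<close>
    have IH: "resolvable TYPE('k) n (up_closure n B)
        (\<lambda>p. if p = 0 then 1 else \<Sum>m\<in>B. (max_var m - 1) choose (p - 1)) (exp_degree u)"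
    proof (rule Suc.hyps(1))
      show "c = card B" using Suc.hyps(2) u finA by (simp add: B_def)
      show "g \<in> B" if "v \<in> B" "g \<in> minimal_elements S" "precedes g v" for g v
        using that B[of v] B[of g] by (auto simp: precedes_def)
      show "B \<subseteq> minimal_elements S" using B by blast
      show "exp_degree v \<le> exp_degree u" if "v \<in> B" for v
        using B[of v] that by (auto simp: precedes_def)
    qed
    have colon: "{w \<in> exponents n. u + w \<in> up_closure n B} = touches n (max_var u - 1)"
      by (rule colon_initial_segment[OF S u'(1,3)]) (use B in auto)
    have "max_var u \<in> {1..n}" using max_var_props(1)[OF u'(3)] u'(2) by (auto simp: exponents_def)
    then have "max_var u - 1 \<le> n" by auto
    then have "resolvable TYPE('k) n {w \<in> exponents n. u + w \<in> up_closure n B} (\<lambda>p. (max_var u - 1) choose p) 1"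
      unfolding colon by (rule resolvable_touches)
    from resolvable_cone[OF IH this]
    have "resolvable TYPE('k) n (up_closure n B \<union> up_closure n {u})
      (\<lambda>p. (if p = 0 then 1 else \<Sum>m\<in>B. (max_var m - 1) choose (p - 1)) +
        (if p = 0 then 0 else (max_var u - 1) choose (p - 1))) (exp_degree u)"
      using u' Suc.prems(1) upset_subset[OF up] minimal_elements_subset[of S]
      by (simp add: upset_up_closure B_def subset_iff)
    moreover have "up_closure n B \<union> up_closure n {u} = up_closure n A"
      using u by (simp add: B_def insert_absorb flip: up_closure_Un)
    moreover have "(\<lambda>p. (if p = 0 then 1 else \<Sum>m\<in>B. (max_var m - 1) choose (p - 1)) +
        (if p = 0 then 0 else (max_var u - 1) choose (p - 1))) =
      (\<lambda>p. if p = 0 then 1 else \<Sum>m\<in>A. (max_var m - 1) choose (p - 1))"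
      using finA u by (auto simp: B_def sum.remove[of A u] fun_eq_iff)
    ultimately show ?case
      using resolvable_mono[OF _ Suc.prems(3)[OF u(1)]] by simp
  qed
  have "exp_degree u \<le> Max (exp_degree ` minimal_elements S)" if "u \<in> minimal_elements S" for u
    using fin that by simp
  then show ?thesis
    using segment[of "minimal_elements S"] up_closure_minimal_elements[OF up] by auto
qed

section \<open>Counting the generators\<close>

definition degree_eq :: "nat \<Rightarrow> nat \<Rightarrow> (nat \<Rightarrow>\<^sub>0 nat) set" where
  "degree_eq n d = {m \<in> exponents n. exp_degree m = d}"

definition degree_ge :: "nat \<Rightarrow> nat \<Rightarrow> (nat \<Rightarrow>\<^sub>0 nat) set" where
  "degree_ge n d = {m \<in> exponents n. d \<le> exp_degree m}"

lemma degree_eq_base: "degree_eq n 0 = {0}" "degree_eq 0 (Suc d) = {}"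
  by (auto simp: degree_eq_def exponents_def)

lemma degree_eq_last_var:
  "{m \<in> degree_eq (Suc n) (Suc d). Suc n \<in> keys m} = (+) (single (Suc n) 1) ` degree_eq (Suc n) d"
proof (intro equalityI subsetI)
  fix m assume m: "m \<in> {m \<in> degree_eq (Suc n) (Suc d). Suc n \<in> keys m}"
  then have eq: "m = single (Suc n) 1 + (m - single (Suc n) 1)"
    using add_diff_single[of "Suc n" m] by simp
  then have "Suc d = Suc (exp_degree (m - single (Suc n) 1))"
    using m exp_degree_add[of "single (Suc n) 1" "m - single (Suc n) 1"] by (simp add: degree_eq_def)
  then have "m - single (Suc n) 1 \<in> degree_eq (Suc n) d"
    using m by (auto simp: degree_eq_def)
  then show "m \<in> (+) (single (Suc n) 1) ` degree_eq (Suc n) d"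
    using eq by blast
qed (auto simp: degree_eq_def keys_add_nat exponents_def)

lemma degree_eq_Suc:
  "degree_eq (Suc n) (Suc d) = degree_eq n (Suc d) \<union> (+) (single (Suc n) 1) ` degree_eq (Suc n) d"
  unfolding degree_eq_last_var[symmetric]
  by (auto simp: degree_eq_def exponents_def le_Suc_eq)

text \<open>Splitting the monomials by divisibility by the last variable gives Pascal's rule.
  Truncated subtraction is harmless: for \<open>n = 0\<close> the value is 1 in degree 0 and 0 in
  positive degree.\<close>

lemma finite_card_degree_eq: "finite (degree_eq n d) \<and> card (degree_eq n d) = (n + d - 1) choose d"
proof (induction n arbitrary: d)
  case 0
  then show ?case by (cases d) (auto simp: degree_eq_base)
next
  case (Suc n)
  show ?case
  proof (induction d)
    case 0
    then show ?case by (simp add: degree_eq_base)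
  next
    case (Suc d)
    have "degree_eq n (Suc d) \<inter> (+) (single (Suc n) 1) ` degree_eq (Suc n) d = {}"
      unfolding degree_eq_last_var[symmetric] by (auto simp: degree_eq_def exponents_def)
    then show ?case
      using Suc.IH \<open>\<And>d. finite (degree_eq n d) \<and> card (degree_eq n d) = (n + d - 1) choose d\<close>[of "Suc d"]
      by (simp add: degree_eq_Suc card_Un_disjoint card_image)
  qed
qed

text \<open>Having \<open>x_i\<close> as largest variable means being a monomial in
  \<open>x_1, ..., x_i\<close> divisible by \<open>x_i\<close>; cancelling \<open>x_i\<close> leaves
  an arbitrary monomial of degree \<open>d - 1\<close> in \<open>i\<close> variables.\<close>

lemma card_degree_eq_max_var:
  assumes "1 \<le> i" "i \<le> n" "1 \<le> d"
  shows "card {m \<in> degree_eq n d. max_var m = i} = (d + i - 2) choose (d - 1)"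
proof -
  obtain i' d' where i: "i = Suc i'" and d: "d = Suc d'"
    using assms by (metis One_nat_def Suc_le_D)
  have "{m \<in> degree_eq n d. max_var m = i} = {m \<in> degree_eq i d. i \<in> keys m}"
  proof (intro equalityI subsetI)
    fix m assume m: "m \<in> {m \<in> degree_eq n d. max_var m = i}"
    then have "m \<noteq> 0" using assms by (auto simp: degree_eq_def)
    from max_var_props[OF this] have "i \<in> keys m" "\<And>j. j \<in> keys m \<Longrightarrow> j \<le> i"
      using m by (auto simp: in_keys_iff) (metis not_le less_irrefl)
    then show "m \<in> {m \<in> degree_eq i d. i \<in> keys m}"
      using m by (auto simp: degree_eq_def exponents_def)
  next
    fix m assume m: "m \<in> {m \<in> degree_eq i d. i \<in> keys m}"
    then have "max_var m = i"
      unfolding max_var_def by (intro Max_eqI) (auto simp: degree_eq_def exponents_def)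
    then show "m \<in> {m \<in> degree_eq n d. max_var m = i}"
      using m assms by (auto simp: degree_eq_def exponents_def)
  qed
  then show ?thesis
    using degree_eq_last_var[of i' d'] finite_card_degree_eq[of i d']
    by (simp add: i d card_image add.commute)
qed

lemma sum_degree_eq_max_var:
  assumes "1 \<le> d"
  shows "(\<Sum>m\<in>degree_eq n d. f (max_var m)) = (\<Sum>i=1..n. ((d + i - 2) choose (d - 1)) * f i)"
proof -
  have "max_var m \<in> {1..n}" if "m \<in> degree_eq n d" for m
  proof -
    have "m \<noteq> 0" using that assms by (auto simp: degree_eq_def)
    from max_var_props(1)[OF this] show ?thesis using that by (auto simp: degree_eq_def exponents_def)
  qed
  then have "(\<Sum>m\<in>degree_eq n d. f (max_var m)) =
      (\<Sum>i=1..n. \<Sum>m | m \<in> degree_eq n d \<and> max_var m = i. f (max_var m))"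
    by (intro sum.group[symmetric]) (use finite_card_degree_eq in auto)
  also have "\<dots> = (\<Sum>i=1..n. ((d + i - 2) choose (d - 1)) * f i)"
    using assms by (intro sum.cong) (auto simp: card_degree_eq_max_var)
  finally show ?thesis .
qed

lemma degree_ge_split:
  assumes "d \<le> exp_degree m"
  shows "\<exists>g w. m = g + w \<and> exp_degree g = d"
  using assms
proof (induction "exp_degree m - d" arbitrary: m)
  case 0
  then show ?case by (intro exI[of _ m] exI[of _ 0]) auto
next
  case (Suc k)
  then have "m \<noteq> 0" by auto
  then obtain i where i: "i \<in> keys m" by fastforce
  let ?m = "m - single i 1"
  have eq: "m = single i 1 + ?m" using add_diff_single[OF i] by simp
  then have "exp_degree m = Suc (exp_degree ?m)"
    using exp_degree_add[of "single i 1" ?m] by simp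
  then have "k = exp_degree ?m - d" "d \<le> exp_degree ?m"
    using Suc.hyps(2) by linarith+
  then obtain g w where "?m = g + w" "exp_degree g = d"
    using Suc.hyps(1)[of ?m] by blast
  then have "m = g + (single i 1 + w)" using eq by (simp add: add_ac)
  then show ?case using \<open>exp_degree g = d\<close> by blast
qed

section \<open>The generators of ideals containing the monomials free of the last variable\<close>

text \<open>The monomial after the substitution \<open>x_n = 1\<close>.\<close>

definition strip :: "nat \<Rightarrow> (nat \<Rightarrow>\<^sub>0 nat) \<Rightarrow> nat \<Rightarrow>\<^sub>0 nat" where
  "strip n m = m - single n (lookup m n)"

lemma lookup_strip: "lookup (strip n m) i = (if i = n then 0 else lookup m i)"
  by (simp add: strip_def lookup_minus lookup_single when_def)

lemma strip_add: "strip n m + single n (lookup m n) = m"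
  by (intro poly_mapping_eqI) (simp add: lookup_add lookup_strip lookup_single when_def)

lemma strip_exponents: "m \<in> exponents n \<Longrightarrow> strip n m \<in> exponents n"
  by (auto simp: strip_def)

lemma exp_degree_strip: "exp_degree (strip n m) + lookup m n = exp_degree m"
  using exp_degree_add[of "strip n m" "single n (lookup m n)"] by (simp add: strip_add)

lemma strip_eqI: "lookup m n = 0 \<Longrightarrow> strip n (m + single n b) = m"
  by (intro poly_mapping_eqI) (auto simp: lookup_strip lookup_add lookup_single when_def)

text \<open>The common setting of \<open>J\<close> and the \<open>d\<close>-th power of the
  irrelevant ideal: a formula in \<open>n\<close> and \<open>d\<close> alone proves their Betti
  numbers equal. The Artinian hypothesis enters as a power of \<open>x_n\<close> in the
  ideal.\<close>

locale last_variable_ideal =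
  fixes n d :: nat and S :: "(nat \<Rightarrow>\<^sub>0 nat) set"
  assumes n: "1 \<le> n" and d: "1 \<le> d"
    and stable: "strongly_stable_set n S"
    and degree: "S \<subseteq> degree_ge n d"
    and free: "\<And>m. m \<in> degree_eq n d \<Longrightarrow> n \<notin> keys m \<Longrightarrow> m \<in> S"
    and power: "\<exists>a. single n a \<in> S"
begin

lemma upset: "upset n S"
  using stable by (simp add: strongly_stable_set_def)

lemma exponents: "m \<in> S \<Longrightarrow> m \<in> exponents n"
  using upset_subset[OF upset] by blast

definition last_power :: "(nat \<Rightarrow>\<^sub>0 nat) \<Rightarrow> nat" where
  "last_power m = (LEAST a. m + single n a \<in> S)"

definition generator :: "(nat \<Rightarrow>\<^sub>0 nat) \<Rightarrow> nat \<Rightarrow>\<^sub>0 nat" where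
  "generator m = strip n m + single n (last_power (strip n m))"

lemma last_power_in:
  assumes "m \<in> exponents n"
  shows "m + single n (last_power m) \<in> S"
proof -
  obtain a where "single n a \<in> S" using power by blast
  from upset_add[OF upset this assms] have "m + single n a \<in> S" by (simp add: add.commute)
  then show ?thesis unfolding last_power_def by (rule LeastI)
qed

lemma last_power_le: "m + single n a \<in> S \<Longrightarrow> last_power m \<le> a"
  unfolding last_power_def by (rule Least_le)

lemma generator_in:
  assumes "m \<in> degree_eq n d"
  shows "generator m \<in> S"
  using assms strip_exponents last_power_in by (auto simp: generator_def degree_eq_def)

lemma lookup_generator: "lookup (generator m) n = last_power (strip n m)"
  by (simp add: generator_def lookup_add lookup_strip)

lemma strip_generator: "strip n (generator m) = strip n m"
  unfolding generator_def by (rule strip_eqI) (simp add: lookup_strip)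

text \<open>A monomial of degree \<open>d\<close> divisible by \<open>x_n\<close> drops below degree
  \<open>d\<close> when stripped, and so leaves the ideal. Thus \<open>x_n\<close> divides the
  generator exactly if it divides \<open>m\<close>.\<close>

lemma last_power_eq_0_iff:
  assumes m: "m \<in> degree_eq n d"
  shows "last_power (strip n m) = 0 \<longleftrightarrow> lookup m n = 0"
proof
  assume "lookup m n = 0"
  then have "strip n m = m" "n \<notin> keys m" using strip_add[of n m] by (auto simp: in_keys_iff)
  then show "last_power (strip n m) = 0"
    using last_power_le[of m 0] free[OF m] by simp
next
  assume "last_power (strip n m) = 0"
  then have "strip n m \<in> S" using generator_in[OF m] by (simp add: generator_def)
  then have "d \<le> exp_degree (strip n m)" using degree by (auto simp: degree_ge_def)
  then show "lookup m n = 0" using exp_degree_strip[of n m] m by (simp add: degree_eq_def)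
qed

lemma generator_free: "m \<in> degree_eq n d \<Longrightarrow> lookup m n = 0 \<Longrightarrow> generator m = m"
  using last_power_eq_0_iff[of m] strip_add[of n m] by (simp add: generator_def)

text \<open>If \<open>x_n\<close> does not divide \<open>m\<close>, the generator has the least
  degree possible in \<open>S\<close>. Otherwise a proper divisor in \<open>S\<close> would allow
  lowering the exponent of \<open>x_n\<close> by one, against the choice of
  \<open>last_power\<close>.\<close>

lemma generator_minimal:
  assumes m: "m \<in> degree_eq n d"
  shows "generator m \<in> minimal_elements S"
proof -
  have "w = 0" if g: "g \<in> S" "generator m = g + w" for g w
  proof (rule ccontr)
    assume "w \<noteq> 0"
    have exp: "g \<in> exponents n" "w \<in> exponents n"
      using exponents[OF generator_in[OF m]] unfolding g(2) exponents_add_iff by auto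
    show False
    proof (cases "lookup m n = 0")
      case True
      then have "exp_degree g + exp_degree w = d"
        using generator_free[OF m] m g(2) exp_degree_add[of g w] by (simp add: degree_eq_def)
      moreover have "d \<le> exp_degree g" using degree g(1) by (auto simp: degree_ge_def)
      ultimately have "exp_degree w = 0" by linarith
      then show False using \<open>w \<noteq> 0\<close> by simp
    next
      case False
      then have pos: "last_power (strip n m) \<noteq> 0" using last_power_eq_0_iff[OF m] by simp
      let ?h = "strip n m + single n (last_power (strip n m) - 1)"
      have "?h \<in> S"
      proof (cases "\<exists>i\<in>keys w. i \<noteq> n")
        case True
        then obtain i where i: "i \<in> keys w" "i \<noteq> n" by blast
        then have "1 \<le> i" "i < n" using exp by (auto simp: exponents_def less_le)
        \<comment> \<open>Dividing by \<open>x_i\<close> stays in \<open>S\<close>, as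
          \<open>x_i\<close> is taken from the cofactor \<open>w\<close>; strong stability then
          trades one \<open>x_n\<close> for the lost \<open>x_i\<close>.\<close>
        have "g + (w - single i 1) \<in> S"
          using upset_add[OF upset g(1)] exp(2) by auto
        moreover have eq: "lookup (g + (w - single i 1)) k = lookup (generator m) k - (if k = i then 1 else 0)" for k
          using i by (auto simp: g(2) lookup_add lookup_minus lookup_single when_def in_keys_iff)
        moreover have nX: "n \<in> keys (g + (w - single i 1))"
          using eq[of n] i(2) pos lookup_generator[of m] by (simp add: in_keys_iff)
        ultimately have "g + (w - single i 1) - single n 1 + single i 1 \<in> S"
          using stable \<open>1 \<le> i\<close> \<open>i < n\<close> unfolding strongly_stable_set_def by blast
        also have "g + (w - single i 1) - single n 1 + single i 1 = ?h"
        proof (rule poly_mapping_eqI)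
          fix k
          have "0 < lookup (generator m) i"
            using i by (simp add: g(2) lookup_add in_keys_iff)
          moreover have "lookup (generator m) k = (if k = n then last_power (strip n m) else lookup (strip n m) k)"
            by (simp add: generator_def lookup_add lookup_single lookup_strip when_def)
          ultimately show "lookup (g + (w - single i 1) - single n 1 + single i 1) k = lookup ?h k"
            using i(2) unfolding lookup_shift[OF nX i(2)] eq
            by (auto simp: lookup_add lookup_single lookup_strip when_def)
        qed
        finally show ?thesis .
      next
        case False
        moreover have "keys w \<noteq> {}" using \<open>w \<noteq> 0\<close> by simp
        ultimately have n: "n \<in> keys w" by (metis all_not_in_conv)
        have "g + (w - single n 1) \<in> S"
          using upset_add[OF upset g(1)] exp(2) by auto
        also have "g + (w - single n 1) = ?h"
        proof (rule poly_mapping_eqI)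
          fix k
          have "lookup g k + lookup w k = (if k = n then last_power (strip n m) else lookup (strip n m) k)"
            using arg_cong[OF g(2), of "\<lambda>m. lookup m k"]
            by (simp add: generator_def lookup_add lookup_single lookup_strip when_def split: if_splits)
          then show "lookup (g + (w - single n 1)) k = lookup ?h k"
            using n by (auto simp: lookup_add lookup_minus lookup_single lookup_strip when_def in_keys_iff)
        qed
        finally show ?thesis .
      qed
      then show False using last_power_le[of "strip n m"] pos by force
    qed
  qed
  then show ?thesis using generator_in[OF m] by (auto simp: minimal_elements_def)
qed

text \<open>The part of \<open>g\<close> free of \<open>x_n\<close> has degree at most
  \<open>d\<close>, since otherwise a proper divisor of degree \<open>d\<close> free of
  \<open>x_n\<close> would lie in \<open>S\<close>. Padding this part with \<open>x_n\<close> up to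
  degree \<open>d\<close> gives the preimage.\<close>

lemma minimal_is_generator:
  assumes g: "g \<in> minimal_elements S"
  shows "\<exists>m\<in>degree_eq n d. generator m = g"
proof -
  have gS: "g \<in> S" "g \<in> exponents n" using g exponents by (auto simp: minimal_elements_def)
  have min: "w = 0" if "h \<in> S" "g = h + w" for h w
    using g that by (auto simp: minimal_elements_def)
  have sd: "exp_degree (strip n g) \<le> d"
  proof (rule ccontr)
    assume "\<not> ?thesis"
    then obtain h w where hw: "strip n g = h + w" "exp_degree h = d"
      using degree_ge_split[of d "strip n g"] by auto
    have "h \<in> exponents n" using strip_exponents[OF gS(2)] unfolding hw(1) exponents_add_iff by simp
    moreover have "lookup (strip n g) n = 0" by (simp add: lookup_strip)
    ultimately have "h \<in> S" using hw by (intro free) (auto simp: degree_eq_def in_keys_iff lookup_add)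
    moreover have "g = h + (w + single n (lookup g n))"
      using strip_add[of n g] by (simp add: hw(1) add.assoc)
    ultimately have "w + single n (lookup g n) = 0" by (rule min)
    then have "exp_degree w + lookup g n = 0"
      using exp_degree_add[of w "single n (lookup g n)"] by simp
    then show False using hw \<open>\<not> exp_degree (strip n g) \<le> d\<close> by simp
  qed
  define m where "m = strip n g + single n (d - exp_degree (strip n g))"
  have strip: "strip n m = strip n g"
    unfolding m_def by (rule strip_eqI) (simp add: lookup_strip)
  have "m \<in> degree_eq n d"
    using sd n strip_exponents[OF gS(2)] by (auto simp: m_def degree_eq_def intro!: exponents_add exponents_single)
  moreover have "last_power (strip n g) = lookup g n"
  proof (rule antisym)
    show le: "last_power (strip n g) \<le> lookup g n"
      using gS(1) by (intro last_power_le) (simp add: strip_add)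
    have "g = strip n g + single n (last_power (strip n g)) + single n (lookup g n - last_power (strip n g))"
      using strip_add[of n g] le by (simp add: add.assoc flip: single_add)
    then have "single n (lookup g n - last_power (strip n g)) = 0"
      by (rule min[OF last_power_in[OF strip_exponents[OF gS(2)]]])
    then have "exp_degree (single n (lookup g n - last_power (strip n g))) = 0" by simp
    then show "lookup g n \<le> last_power (strip n g)" by simp
  qed
  ultimately show ?thesis
    by (intro bexI[of _ m]) (simp_all add: generator_def strip strip_add)
qed

text \<open>Injectivity: the stripped part is kept, and the fixed degree \<open>d\<close> then
  determines the exponent of \<open>x_n\<close>.\<close>

lemma bij_generator: "bij_betw generator (degree_eq n d) (minimal_elements S)"
  unfolding bij_betw_def
proof
  show "inj_on generator (degree_eq n d)"
  proof (rule inj_onI)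
    fix m m' assume m: "m \<in> degree_eq n d" "m' \<in> degree_eq n d" and "generator m = generator m'"
    then have "strip n m = strip n m'" by (metis strip_generator)
    moreover from this have "lookup m n = lookup m' n"
      using m exp_degree_strip[of n m] exp_degree_strip[of n m'] by (simp add: degree_eq_def)
    ultimately show "m = m'" by (metis strip_add)
  qed
  show "generator ` degree_eq n d = minimal_elements S"
    using generator_minimal minimal_is_generator by blast
qed

lemma max_var_generator:
  assumes m: "m \<in> degree_eq n d"
  shows "max_var (generator m) = max_var m"
proof (cases "lookup m n = 0")
  case True
  then show ?thesis using generator_free[OF m] by simp
next
  case False
  have "max_var m' = n" if "m' \<in> exponents n" "lookup m' n \<noteq> 0" for m'
    using that unfolding max_var_def by (intro Max_eqI) (auto simp: exponents_def in_keys_iff subset_iff)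
  then show ?thesis
    using False m last_power_eq_0_iff[OF m] lookup_generator[of m] exponents[OF generator_in[OF m]]
    by (simp add: degree_eq_def)
qed

lemma finite_minimal_elements: "finite (minimal_elements S)"
  and card_minimal_elements: "card (minimal_elements S) = card (degree_eq n d)"
  using bij_betw_finite[OF bij_generator] bij_betw_same_card[OF bij_generator] finite_card_degree_eq by auto

lemma zero_notin: "0 \<notin> S"
  using degree d by (auto simp: degree_ge_def)

theorem betti_formula:
  assumes "1 \<le> p"
  shows "betti n (quotient_module n (supported_on S :: 'k::field mpoly set)) p =
    (\<Sum>i=1..n. ((d + i - 2) choose (d - 1)) * ((i - 1) choose (p - 1)))"
proof -
  obtain D where D: "resolvable TYPE('k) n S
    (\<lambda>p. if p = 0 then 1 else \<Sum>m\<in>minimal_elements S. (max_var m - 1) choose (p - 1)) D"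
    using resolvable_strongly_stable[OF stable zero_notin finite_minimal_elements] by blast
  have "betti n (quotient_module n (supported_on S :: 'k mpoly set)) p =
      (\<Sum>m\<in>minimal_elements S. (max_var m - 1) choose (p - 1))"
    using betti_resolvable[OF D upset, of p] assms by simp
  also have "\<dots> = (\<Sum>m\<in>degree_eq n d. (max_var m - 1) choose (p - 1))"
    using sum.reindex_bij_betw[OF bij_generator, of "\<lambda>m. (max_var m - 1) choose (p - 1)"]
    by (simp add: max_var_generator)
  also have "\<dots> = (\<Sum>i=1..n. ((d + i - 2) choose (d - 1)) * ((i - 1) choose (p - 1)))"
    by (rule sum_degree_eq_max_var[OF d])
  finally show ?thesis .
qed

lemma minimal_generators:
  "minimal_monomial_generators n (supported_on S :: 'k::field mpoly set) (monomial ` minimal_elements S)"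
  unfolding minimal_monomial_generators_def
proof (intro conjI allI impI)
  have sub: "minimal_elements S \<subseteq> exponents n"
    using minimal_elements_subset exponents by blast
  then show "monomial ` minimal_elements S \<subseteq> monomial ` exponents n"
    by blast
  show "supported_on S = genideal (poly_ring n) (monomial ` minimal_elements S :: 'k mpoly set)"
    by (simp add: genideal_monomials[OF sub] up_closure_minimal_elements[OF upset])
  fix H :: "'k mpoly set" assume H: "H \<subset> monomial ` minimal_elements S"
  then obtain T where T: "T \<subseteq> minimal_elements S" "H = monomial ` T"
    by (metis psubset_imp_subset subset_image_iff)
  then obtain u where u: "u \<in> minimal_elements S" "u \<notin> T" using H by blast
  show "genideal (poly_ring n) H \<noteq> supported_on S"
  proof
    assume "genideal (poly_ring n) H = supported_on S"
    then have "supported_on (up_closure n T) = (supported_on S :: 'k mpoly set)"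
      using genideal_monomials[OF subset_trans[OF T(1) sub]] unfolding T(2) by metis
    moreover have "(monomial u :: 'k mpoly) \<in> supported_on S"
      using u by (simp add: minimal_elements_def)
    ultimately have "u \<in> up_closure n T" using monomial_in_supported_on by blast
    then obtain g w where gw: "g \<in> T" "u = g + w" by (auto simp: up_closure_def)
    then have "g \<in> S" using T(1) minimal_elements_subset by blast
    then have "w = 0" using u(1) gw(2) by (simp add: minimal_elements_def)
    then show False using u(2) gw by simp
  qed
qed

end

section \<open>Powers of the irrelevant ideal, and the Artinian condition\<close>

text \<open>A monomial of degree at least \<open>d + 1\<close> splits off one variable and leaves
  degree at least \<open>d\<close>, so it is a single product; the ideal product is closed under
  sums.\<close>

lemma irrelevant_power_eq: "(irrelevant_power n d :: 'k::field mpoly set) = supported_on (degree_ge n d)"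
proof (induction d)
  case 0
  then show ?case by (simp add: irrelevant_power_def ideals_set_def degree_ge_def)
next
  case (Suc d)
  let ?I = "supported_on (degree_ge n d) :: 'k mpoly set" and ?M = "irrelevant_ideal n :: 'k mpoly set"
  let ?P = "ideal_prod (poly_ring n) ?I ?M"
  have "irrelevant_power n (Suc d) = ?P"
    using Suc by (simp add: irrelevant_power_def ideals_set_def)
  also have "\<dots> = supported_on (degree_ge n (Suc d))"
  proof (intro equalityI subsetI)
    fix f assume "f \<in> ?P"
    then show "f \<in> supported_on (degree_ge n (Suc d))"
    proof induction
      case (prod f g)
      have "a + b \<in> degree_ge n (Suc d)" if "a \<in> degree_ge n d" "b \<in> exponents n - {0}" for a b
      proof -
        have "0 < exp_degree b" using that by simp
        then have "Suc d \<le> exp_degree (a + b)" using that by (simp add: degree_ge_def del: exp_degree_pos)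
        then show ?thesis using that by (auto simp: degree_ge_def)
      qed
      then show ?case
        using prod unfolding poly_ring_simps irrelevant_ideal_eq by (rule supported_on_mult[rotated 2])
    qed auto
  next
    fix f :: "'k mpoly" assume f: "f \<in> supported_on (degree_ge n (Suc d))"
    have terms: "single m (lookup f m) \<in> ?P" if m: "m \<in> keys f" for m
    proof -
      have m': "m \<in> exponents n" "Suc d \<le> exp_degree m"
        using f m by (auto simp: supported_on_def degree_ge_def)
      then have "m \<noteq> 0" by auto
      then obtain i where i: "i \<in> keys m" by fastforce
      have eq: "single i 1 + (m - single i 1) = m" by (rule add_diff_single[OF i])
      have "Suc (exp_degree (m - single i 1)) = exp_degree m"
        using exp_degree_add[of "single i 1" "m - single i 1"] unfolding eq by simp
      then have "m - single i 1 \<in> degree_ge n d"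
        using m' by (auto simp: degree_ge_def)
      moreover have "single i 1 \<in> exponents n - {0}"
        using i m'(1) by (auto simp: exponents_def simp flip: exp_degree_eq_0)
      ultimately have "single (m - single i 1) (lookup f m) \<otimes>\<^bsub>poly_ring n\<^esub> monomial (single i 1) \<in> ?P"
        by (intro ideal_prod.prod) (simp_all add: irrelevant_ideal_eq single_in_supported_on)
      then show ?thesis
        using eq by (simp add: monomial_def mult_single add.commute)
    qed
    have zero: "0 \<in> ?P"
      using ideal_prod.prod[of 0 ?I 0 ?M "poly_ring n"] by (simp add: irrelevant_ideal_eq)
    have "sum h A \<in> ?P" if "\<And>m. m \<in> A \<Longrightarrow> h m \<in> ?P" for h :: "_ \<Rightarrow> 'k mpoly" and A :: "(nat \<Rightarrow>\<^sub>0 nat) set"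
      using that
      by (induction A rule: infinite_finite_induct)
         (auto simp: zero intro: ideal_prod.sum[where R = "poly_ring n", simplified])
    from this[of "keys f" "\<lambda>m. single m (lookup f m)"] show "f \<in> ?P"
      using terms by (simp flip: poly_mapping_eq_sum_single)
  qed
  finally show ?case .
qed

lemma last_variable_ideal_degree_ge:
  assumes "1 \<le> n" "1 \<le> d"
  shows "last_variable_ideal n d (degree_ge n d)"
proof
  have "exp_degree (m - single i 1 + single j 1) = exp_degree m" if "i \<in> keys m" for m i j
    by (rule exp_degree_shift[OF that])
  then show "strongly_stable_set n (degree_ge n d)"
    using assms(1)
    by (auto simp: strongly_stable_set_def upset_def degree_ge_def exponents_def[of n] subset_iff
        in_keys_iff lookup_add lookup_minus lookup_single when_def split: if_splits)
  show "\<exists>a. single n a \<in> degree_ge n d"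
    using assms by (intro exI[of _ d]) (auto simp: degree_ge_def)
qed (use assms in \<open>auto simp: degree_ge_def degree_eq_def\<close>)

text \<open>The images of \<open>I + (x_n^i)\<close> form a descending chain. Once it is stationary
  at \<open>N\<close>, \<open>x_n^N\<close> lies in \<open>I + (x_n^(N+1))\<close>; being a
  monomial, it lies in \<open>I\<close> or is a multiple of \<open>x_n^(N+1)\<close>, and the degree
  excludes the latter.\<close>

lemma artinian_quotient_power:
  assumes S: "upset n S" and n: "1 \<le> n"
    and art: "artinian_ring (poly_ring n Quot (supported_on S :: 'k::field mpoly set))"
  shows "\<exists>a. single n a \<in> S"
proof -
  let ?J = "supported_on S :: 'k mpoly set"
  interpret cring "poly_ring n :: 'k mpoly ring" by (rule cring_poly_ring)
  define T where "T i = S \<union> up_closure n {single n i}" for i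
  define I where "I i = (\<lambda>f. ?J +>\<^bsub>poly_ring n\<^esub> f) ` (supported_on (T i) :: 'k mpoly set)" for i
  have x: "single n i \<in> exponents n" for i using n by auto
  have T: "upset n (T i)" for i
    using S upset_up_closure[of "{single n i}" n] x by (auto simp: T_def upset_def)
  have "ideal (I i) (poly_ring n Quot ?J)" for i
    unfolding I_def
    by (rule ring_ideal_imp_quot_ideal[OF ideal_supported_on[OF S] ideal_supported_on[OF T]])
  moreover have "I (Suc i) \<subseteq> I i" for i
  proof -
    have "single n (Suc i) \<in> up_closure n {single n i}"
      using x[of 1] single_add[of n i 1] by (auto simp: up_closure_def)
    then have "T (Suc i) \<subseteq> T i"
      using up_closure_least[OF upset_up_closure[of "{single n i}" n], of "{single n (Suc i)}"] x
      by (auto simp: T_def)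
    then show ?thesis unfolding I_def by (intro image_mono supported_on_mono)
  qed
  ultimately obtain N where N: "\<And>i. i \<ge> N \<Longrightarrow> I i = I N"
    using art unfolding artinian_ring_def by blast
  have "single n N \<in> T N" using up_closure_superset[of "{single n N}" n] by (auto simp: T_def)
  then have "?J +>\<^bsub>poly_ring n\<^esub> monomial (single n N) \<in> I (Suc N)"
    using N[of "Suc N"] by (auto simp: I_def)
  then obtain f where f: "f \<in> supported_on (T (Suc N))" "monomial (single n N) - f \<in> ?J"
    by (auto simp: I_def coset_eq_iff)
  have "?J \<subseteq> supported_on (T (Suc N))" by (rule supported_on_mono) (simp add: T_def)
  then have "monomial (single n N) - f + f \<in> (supported_on (T (Suc N)) :: 'k mpoly set)"
    using f by (intro supported_on_add) auto
  then have "single n N \<in> T (Suc N)" by simp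
  moreover have "single n N \<notin> up_closure n {single n (Suc N)}"
  proof
    assume "single n N \<in> up_closure n {single n (Suc N)}"
    then obtain w where "single n N = single n (Suc N) + w" by (auto simp: up_closure_def)
    from arg_cong[OF this, of exp_degree] show False by simp
  qed
  ultimately show ?thesis by (auto simp: T_def)
qed

lemma strongly_stable_supported_on:
  assumes "strongly_stable n J"
  obtains S where "J = supported_on S" "strongly_stable_set n S"
proof -
  obtain T where T: "T \<subseteq> exponents n" "J = genideal (poly_ring n) (monomial ` T)"
    using assms by (auto simp: strongly_stable_def monomial_ideal_def)
  then have J: "J = supported_on (up_closure n T)" by (simp add: genideal_monomials)
  have "strongly_stable_set n (up_closure n T)"
    using assms upset_up_closure[OF T(1)] upset_subset[OF upset_up_closure[OF T(1)]]
    unfolding strongly_stable_def strongly_stable_set_def J monomial_in_supported_on by blast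
  then show ?thesis using that J by blast
qed

text \<open>Polynomials with all terms of degree at least \<open>d\<close> form an ideal, which
  contains the given generators and hence the ideal that they generate.\<close>

lemma generated_in_degrees_ge_supported_on:
  assumes "generated_in_degrees_ge n d (supported_on S :: 'k::field mpoly set)"
  shows "S \<subseteq> degree_ge n d"
proof
  interpret cring "poly_ring n :: 'k mpoly ring" by (rule cring_poly_ring)
  fix m assume m: "m \<in> S"
  obtain G :: "'k mpoly set" where G: "G \<subseteq> (\<Union>e\<in>{int d..}. homogeneous_part n e)"
    "supported_on S = genideal (poly_ring n) G"
    using assms by (auto simp: generated_in_degrees_ge_def)
  have "upset n (degree_ge n d)" by (auto simp: upset_def degree_ge_def)
  moreover have "G \<subseteq> supported_on (degree_ge n d)"
    using G(1) by (force simp: homogeneous_part_def supported_on_def degree_ge_def)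
  ultimately have "supported_on S \<subseteq> (supported_on (degree_ge n d) :: 'k mpoly set)"
    unfolding G(2) by (intro genideal_minimal ideal_supported_on)
  moreover have "(monomial m :: 'k mpoly) \<in> supported_on S" using m by simp
  ultimately show "m \<in> degree_ge n d" using monomial_in_supported_on by blast
qed

lemma inj_monomial: "inj (monomial :: (nat \<Rightarrow>\<^sub>0 nat) \<Rightarrow> 'k::field mpoly)"
  by (rule injI) (metis monomial_in_supported_on singletonD singletonI)

lemma k_dim_homogeneous_part:
  "k_dim (homogeneous_part n (int d) :: 'k::field mpoly set) = card (degree_eq n d)"
proof -
  interpret V: vector_space "\<lambda>(c::'k) (f :: 'k mpoly). single 0 c * f"
    by standard (auto simp: algebra_simps single_add mult_single simp flip: mult.assoc)
  let ?B = "monomial ` degree_eq n d :: 'k mpoly set"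
  have scale: "single 0 c * monomial m = single m c" for c :: 'k and m
    by (simp add: monomial_def mult_single)
  have "V.dim (homogeneous_part n (int d)) = card (degree_eq n d)"
  proof (rule V.dim_unique)
    show "?B \<subseteq> homogeneous_part n (int d)"
      by (auto simp: homogeneous_part_eq exponents_of_degree_def degree_eq_def)
    show "homogeneous_part n (int d) \<subseteq> V.span ?B"
    proof
      fix f :: "'k mpoly" assume f: "f \<in> homogeneous_part n (int d)"
      have "single m (lookup f m) \<in> V.span ?B" if "m \<in> keys f" for m
      proof -
        have "m \<in> degree_eq n d"
          using f that by (auto simp: homogeneous_part_def supported_on_def degree_eq_def)
        then have "single 0 (lookup f m) * monomial m \<in> V.span ?B"
          by (intro V.span_scale V.span_base imageI)
        then show ?thesis by (simp add: scale)
      qed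
      then have "(\<Sum>m\<in>keys f. single m (lookup f m)) \<in> V.span ?B"
        by (rule V.span_sum)
      then show "f \<in> V.span ?B" by (simp flip: poly_mapping_eq_sum_single)
    qed
    show "V.independent ?B"
      unfolding V.independent_explicit_module
    proof (intro allI impI)
      fix t and c :: "'k mpoly \<Rightarrow> 'k" and v
      assume t: "finite t" "t \<subseteq> ?B" "(\<Sum>v\<in>t. single 0 (c v) * v) = 0" "v \<in> t"
      obtain m where m: "v = monomial m" using t by blast
      have "0 = (\<Sum>w\<in>t. lookup (single 0 (c w) * w) m)"
        using t(3) by (simp flip: lookup_sum)
      also have "\<dots> = (\<Sum>w\<in>t. if w = v then c v else 0)"
      proof (rule sum.cong)
        fix w assume "w \<in> t"
        then obtain m' where m': "w = monomial m'" using t by blast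
        have "w = v \<longleftrightarrow> m' = m" using inj_eq[OF inj_monomial] by (simp add: m m')
        moreover have "lookup (single 0 (c w) * w) m = (if m' = m then c w else 0)"
          unfolding m' scale by (simp add: lookup_single when_def)
        ultimately show "lookup (single 0 (c w) * w) m = (if w = v then c v else 0)" by auto
      qed simp
      also have "\<dots> = c v" using t by simp
      finally show "c v = 0" by simp
    qed
    show "card ?B = card (degree_eq n d)"
      by (rule card_image) (rule inj_on_subset[OF inj_monomial], simp)
  qed
  then show ?thesis by (simp add: k_dim_def)
qed

theorem theorem4p1:
  fixes n d :: nat and J :: "'k::field mpoly set"
  assumes "1 \<le> n" and "2 \<le> d"
    and "strongly_stable n J"
    and "generated_in_degrees_ge n d J"
    and "\<forall>m\<in>exponents n. exp_degree m = d \<and> n \<notin> Poly_Mapping.keys m \<longrightarrow> monomial m \<in> J"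
    and "artinian_ring (poly_ring n Quot J)"
  shows "(\<forall>p\<ge>1.
            betti n (quotient_module n J) p =
              betti n (quotient_module n (irrelevant_power n d :: 'k mpoly set)) p \<and>
            betti n (quotient_module n (irrelevant_power n d :: 'k mpoly set)) p =
              (\<Sum>i=1..n. ((d + i - 2) choose (d - 1)) * ((i - 1) choose (p - 1)))) \<and>
         (\<exists>G. minimal_monomial_generators n J G \<and> finite G \<and>
              card G = k_dim (homogeneous_part n (int d) :: 'k mpoly set))"
proof -
  obtain S where J: "J = supported_on S" and S: "strongly_stable_set n S"
    using strongly_stable_supported_on[OF assms(3)] by blast
  interpret J: last_variable_ideal n d S
  proof
    show "S \<subseteq> degree_ge n d"
      using generated_in_degrees_ge_supported_on assms(4) unfolding J by blast
    show "\<exists>a. single n a \<in> S"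
      using artinian_quotient_power S assms(1,6) unfolding J strongly_stable_set_def by blast
  qed (use assms(1,2,5) S in \<open>auto simp: J degree_eq_def\<close>)
  interpret M: last_variable_ideal n d "degree_ge n d"
    using last_variable_ideal_degree_ge assms(1,2) by simp
  have "finite (monomial ` minimal_elements S :: 'k mpoly set)"
    using J.finite_minimal_elements by simp
  \<comment> \<open>The minimal generators are in bijection with the monomials of degree
    \<open>d\<close>, a basis of \<open>R_d\<close>.\<close>
  moreover have "card (monomial ` minimal_elements S :: 'k mpoly set) =
      k_dim (homogeneous_part n (int d) :: 'k mpoly set)"
    using card_image[OF inj_on_subset[OF inj_monomial subset_UNIV]] J.card_minimal_elements
    by (metis k_dim_homogeneous_part)
  ultimately show ?thesis
    using J.minimal_generators[where 'k = 'k] unfolding J irrelevant_power_eq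
    by (auto simp: J.betti_formula M.betti_formula)
qed

end
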